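(* Let $0 \le a < b$ and let $X$ be uniform on $[a,b]$. For each $n$, let the weights $w_1\le\cdots\le w_n$ of a weighted voting game be $n$ independent samples of $X$ sorted in non-decreasing order, and let $\varphi_1,\varphi_n$ be the Shapley values of agents $1$ and $n$. For every $\epsilon>0$ there exist $\psi<1$ and $K>0$ such that: (1) for all $q \in [n^{-3/4}, 1-\epsilon]$, \[ \mathbb{E}[\varphi_n(qn\mathbb{E}[X])] = \frac{1}{b-a}\int_a^b \Big(\frac{t-a}{b-a}\Big)^{n-1}\frac{2t}{a+t}\,dt \pm O(\psi^{n^{1/4}}), \] and \[ \frac{1}{b-a}\int_a^b \Big(\frac{t-a}{b-a}\Big)^{n-1}\frac{2t}{a+t}\,dt = \frac{2b}{a+b}\frac{1}{n} - \frac{2a}{a+b}\sum_{d=1}^\infty \Big(\frac{b-a}{a+b}\Big)^d \frac{d!}{n(n+1)\cdots(n+d)}; \] in particular, when $a=0$ this integral equals $2/n$; (2) for all $q \in [n^{-3/4}, 1-Kn^{-1/3}]$, \[ \mathbb{E}[\varphi_1(qn\mathbb{E}[X])] = \frac{1}{b-a}\int_a^b \Big(\frac{b-t}{b-a}\Big)^{n-1}\frac{2t}{b+t}\,dt \pm O(\psi^{n^{1/4}}), \] and \[ \frac{1}{b-a}\int_a^b \Big(\frac{b-t}{b-a}\Big)^{n-1}\frac{2t}{b+t}\,dt = \frac{2a}{a+b}\frac{1}{n} - \frac{2b}{a+b}\sum_{d=1}^\infty \Big(\frac{a-b}{a+b}\Big)^d \frac{d!}{n(n+1)\cdots(n+d)};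 \] in particular, when $a=0$ this integral equals $2\sum_{d=1}^\infty \frac{(-1)^{d+1} d!}{n(n+1)\cdots(n+d)}$.
   Context: Shapley value of agent $i$ at quota $Q$: $\varphi_i(Q) = \Pr_{\pi}[Q - w_i \le \sum_{j \text{ precedes } i \text{ in }\pi} w_j < Q]$, with $\pi$ a uniformly random ordering of the agents. Expectations are over the random weights; implied constants do not depend on $n$ or $q$. *)

theory Defs
  imports "HOL-Probability.Probability" "HOL-Combinatorics.Permutations"
begin

text \<open>Shapley value of agent i (agents are 0,...,n-1) in the weighted voting game
with weights w and quota Q: the probability, over a uniformly random ordering
(a bijection pi from agents to positions; j precedes i iff pi j < pi i), that
Q - w i <= (sum of weights preceding i) < Q.\<close>
definition shapley :: "nat \<Rightarrow> (nat \<Rightarrow> real) \<Rightarrow> real \<Rightarrow> nat \<Rightarrow> real" where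
  "shapley n w Q i =
     measure_pmf.prob (pmf_of_set {\<pi>. \<pi> permutes {..<n}})
       {\<pi>. Q - w i \<le> (\<Sum>j\<in>{j. j < n \<and> \<pi> j < \<pi> i}. w j)
            \<and> (\<Sum>j\<in>{j. j < n \<and> \<pi> j < \<pi> i}. w j) < Q}"

definition unif :: "real \<Rightarrow> real \<Rightarrow> real measure" where
  "unif a b = uniform_measure lborel {a..b}"

definition samples :: "nat \<Rightarrow> real \<Rightarrow> real \<Rightarrow> (nat \<Rightarrow> real) measure" where
  "samples n a b = PiM {..<n} (\<lambda>_. unif a b)"

definition sorted_weights :: "nat \<Rightarrow> (nat \<Rightarrow> real) \<Rightarrow> nat \<Rightarrow> real" where
  "sorted_weights n x = (\<lambda>k. sort (map x [0..<n]) ! k)"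

definition exp_shapley :: "nat \<Rightarrow> real \<Rightarrow> real \<Rightarrow> nat \<Rightarrow> real \<Rightarrow> real" where
  "exp_shapley n a b i Q =
     (\<integral>x. shapley n (sorted_weights n x) Q i \<partial>samples n a b)"

definition mean_unif :: "real \<Rightarrow> real \<Rightarrow> real" where
  "mean_unif a b = (\<integral>t. t \<partial>unif a b)"

end

theory Submission
  imports Defs
begin

text \<open>
  Given that the largest (smallest) weight equals \<open>t\<close>, the other weights are independent and uniform on
  \<open>[a, t]\<close> (on \<open>[t, b]\<close>), so the expected Shapley value is the average over \<open>t\<close> of \<open>1/n\<close> times the
  expected number of partial sums \<open>S\<^sub>0, \<dots>, S\<^sub>n\<^sub>-\<^sub>1\<close> that hit the window \<open>[Q - t, Q)\<close>. Over all
  \<open>k\<close>, the expected number \<open>G(Q)\<close> of hits satisfies a renewal equation. Integrating that equation once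
  shows that \<open>G\<close> can neither stay above nor stay below \<open>L = t / E[X]\<close> throughout a window, and since \<open>G\<close>
  averages itself, its oscillation around \<open>L\<close> contracts geometrically, uniformly in \<open>t\<close>. The
  terms with \<open>k \<ge> n\<close> are negligible by Chernoff's bound, and extreme values of \<open>t\<close> are exponentially unlikely.
\<close>

section \<open>Integrals over the uniform distribution\<close>

text \<open>The law of the steps and the width of the window both change with the extremal weight
  \<open>t\<close>, so a convergence rate that is not uniform in \<open>t\<close> would not survive
  the final average. The contraction argument gives constants that depend only on a lower bound for
  the length of the step interval and on upper bounds for its right end and for the window.

  The two ranges of quotas reflect the mean of the remaining weights. For the largest agent this
  mean is \<open>(a + t) / 2\<close>, which lies below \<open>E[X]\<close>, but only by a small
  multiple of \<epsilon> when \<open>t\<close> is close to \<open>b\<close>; the quota then leaves a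
  gap linear in \<open>n\<close>, and a fixed Chernoff parameter suffices. For the smallest agent
  the mean \<open>(t + b) / 2\<close> is at least \<open>E[X]\<close> for every \<open>t\<close>, so
  the quota may come within order \<open>n^(2/3)\<close> of \<open>n E[X]\<close>; the Chernoff
  parameter then shrinks like \<open>n^(-1/3)\<close>, which puts linear gain and quadratic loss
  both at order \<open>n^(1/3)\<close>.\<close>

lemma sets_unif [simp, measurable_cong]: "sets (unif c d) = sets borel"
  by (simp add: unif_def)

lemma space_unif [simp]: "space (unif c d) = UNIV"
  by (simp add: unif_def)

lemma prob_space_unif: "c < d \<Longrightarrow> prob_space (unif c d)"
  unfolding unif_def by (rule prob_space_uniform_measure) auto

lemma unif_eq_density:
  assumes "c < d"
  shows "unif c d = density lborel (\<lambda>x. ennreal (indicator {c..d} x / (d - c)))"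
proof -
  have "indicator {c..d} x / emeasure lborel {c..d} = ennreal (indicator {c..d} x / (d - c))" for x
    using assms by (auto simp: indicator_def divide_ennreal simp flip: ennreal_1)
  then show ?thesis by (simp add: unif_def uniform_measure_def)
qed

lemma AE_unif: "c < d \<Longrightarrow> AE s in unif c d. s \<in> {c..d}"
  unfolding unif_def by (rule AE_uniform_measureI) auto

lemma integrable_unif:
  fixes f :: "real \<Rightarrow> real"
  assumes "c < d" and [measurable]: "f \<in> borel_measurable borel"
    and "\<And>s. s \<in> {c..d} \<Longrightarrow> \<bar>f s\<bar> \<le> B"
  shows "integrable (unif c d) f"
proof -
  interpret prob_space "unif c d" by (rule prob_space_unif) fact
  show ?thesis
    by (rule integrable_const_bound[where B = B]) (use assms AE_unif[OF \<open>c < d\<close>] in auto)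
qed

lemma integral_unif_lborel:
  fixes f :: "real \<Rightarrow> real"
  assumes "c < d" and [measurable]: "f \<in> borel_measurable borel"
  shows "(\<integral>s. f s \<partial>unif c d) = (LINT s:{c..d}|lborel. f s) / (d - c)"
proof -
  have "(\<integral>s. f s \<partial>unif c d) = (\<integral>s. indicator {c..d} s / (d - c) * f s \<partial>lborel)"
    using assms by (subst unif_eq_density) (auto simp: integral_density)
  also have "\<dots> = (\<integral>s. (indicator {c..d} s * f s) / (d - c) \<partial>lborel)"
    by (intro Bochner_Integration.integral_cong) auto
  also have "\<dots> = (LINT s:{c..d}|lborel. f s) / (d - c)"
    by (simp only: set_lebesgue_integral_def real_scaleR_def integral_divide_zero)
  finally show ?thesis .
qed

lemma bounded_borel_on_Icc:
  fixes f :: "real \<Rightarrow> real"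
  assumes [measurable]: "f \<in> borel_measurable borel"
    and "\<And>s. s \<in> {c..d} \<Longrightarrow> \<bar>f s\<bar> \<le> B"
  shows "set_integrable lborel {c..d} f"
  unfolding set_integrable_def
proof (rule Bochner_Integration.integrable_bound)
  show "integrable lborel (\<lambda>s. indicator {c..d} s * B :: real)"
    by (cases "c \<le> d") auto
qed (use assms(2) in \<open>auto simp: indicator_def intro: order_trans[OF _ abs_ge_self]\<close>)

lemma integrable_on_Icc_borel:
  fixes f :: "real \<Rightarrow> real"
  assumes "f \<in> borel_measurable borel" and "\<And>s. s \<in> {c..d} \<Longrightarrow> \<bar>f s\<bar> \<le> B"
  shows "f integrable_on {c..d}"
  using bounded_borel_on_Icc[OF assms] by (rule set_borel_integral_eq_integral)

lemma integral_unif: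
  fixes f :: "real \<Rightarrow> real"
  assumes "c < d" and "f \<in> borel_measurable borel" and "\<And>s. s \<in> {c..d} \<Longrightarrow> \<bar>f s\<bar> \<le> B"
  shows "(\<integral>s. f s \<partial>unif c d) = integral {c..d} f / (d - c)"
  using integral_unif_lborel[OF assms(1,2)] set_borel_integral_eq_integral(2)[OF bounded_borel_on_Icc[OF assms(2,3)]]
  by simp

lemma mean_unif_eq:
  assumes "a < b"
  shows "mean_unif a b = (a + b) / 2"
proof -
  have "mean_unif a b = integral {a..b} (\<lambda>t. t) / (b - a)"
    unfolding mean_unif_def using assms
    by (intro integral_unif[where B = "\<bar>a\<bar> + \<bar>b\<bar>"]) auto
  also have "integral {a..b} (\<lambda>t. t) = (b^2 - a^2) / 2"
    using assms by (simp add: ident_has_integral integral_unique diff_divide_distrib)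
  also have "\<dots> / (b - a) = (a + b) / 2"
    using assms by (simp add: power2_eq_square field_simps)
  finally show ?thesis .
qed

text \<open>The set \<open>I\<close> is only sandwiched between the open and the closed interval, so
  that strict and non-strict comparisons with a tied weight are covered alike: the endpoints are
  null sets.\<close>

lemma integral_unif_indicator:
  fixes f :: "real \<Rightarrow> real"
  assumes "a \<le> c" "c \<le> d" "d \<le> b" "a < b" and [measurable]: "f \<in> borel_measurable borel" "I \<in> sets borel"
    and I: "{c<..<d} \<subseteq> I" "I \<inter> {a..b} \<subseteq> {c..d}"
  shows "(\<integral>s. indicator I s * f s \<partial>unif a b) = (d - c) / (b - a) * (\<integral>s. f s \<partial>unif c d)"
proof -
  have "(\<integral>s. indicator I s * f s \<partial>unif a b) = (\<integral>s. indicator {a..b} s * (indicator I s * f s) \<partial>lborel) / (b - a)"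
    using assms by (subst integral_unif_lborel) (auto simp: set_lebesgue_integral_def)
  also have "(\<integral>s. indicator {a..b} s * (indicator I s * f s) \<partial>lborel) = (\<integral>s. indicator {c..d} s * f s \<partial>lborel)"
  proof (rule integral_cong_AE)
    have "AE s in lborel. s \<noteq> c \<and> s \<noteq> d"
      using AE_lborel_singleton[of c] AE_lborel_singleton[of d] by eventually_elim auto
    then show "AE s in lborel. indicator {a..b} s * (indicator I s * f s) = indicator {c..d} s * f s"
    proof eventually_elim
      case (elim s)
      have "s \<in> {a..b} \<and> s \<in> I \<longleftrightarrow> s \<in> {c..d}"
      proof
        assume "s \<in> {c..d}"
        then have "s \<in> {c<..<d}" using elim by simp
        then show "s \<in> {a..b} \<and> s \<in> I" using assms by auto
      qed (use I in blast)
      then show ?case by (auto simp: indicator_def)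
    qed
  qed auto
  also have "\<dots> / (b - a) = (d - c) / (b - a) * (\<integral>s. f s \<partial>unif c d)"
  proof (cases "c < d")
    case True
    then show ?thesis by (subst integral_unif_lborel) (auto simp: set_lebesgue_integral_def)
  next
    \<comment> \<open>The factor \<open>d - c\<close> vanishes, so the value of the integral over
      the degenerate \<open>unif c d\<close> does not matter.\<close>
    case False
    then have "c = d" using assms by auto
    have "AE s in lborel. indicator {c..d} s * f s = 0"
      using AE_lborel_singleton[of c] by eventually_elim (auto simp: \<open>c = d\<close> indicator_def)
    then have "(\<integral>s. indicator {c..d} s * f s \<partial>lborel) = 0"
      by (rule integral_eq_zero_AE)
    then show ?thesis using \<open>c = d\<close> by simp
  qed
  finally show ?thesis .
qed

section \<open>The renewal equation\<close>

lemma integral_reflect_shift: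
  fixes f :: "real \<Rightarrow> real"
  assumes [measurable]: "f \<in> borel_measurable borel" and bd: "\<And>z. z \<in> {x-d..x-c} \<Longrightarrow> \<bar>f z\<bar> \<le> B"
  shows "integral {c..d} (\<lambda>s. f (x - s)) = integral {x-d..x-c} f"
proof -
  have "integral {x-d..x-c} f = (\<integral>z. indicator {x-d..x-c} z * f z \<partial>lborel)"
    using set_borel_integral_eq_integral(2)[OF bounded_borel_on_Icc[OF assms]]
    by (simp add: set_lebesgue_integral_def)
  also have "\<dots> = (\<integral>s. indicator {c..d} s * f (x - s) \<partial>lborel)"
    by (subst lborel_integral_real_affine[of "-1" _ x])
       (auto intro!: Bochner_Integration.integral_cong simp: indicator_def)
  also have "\<dots> = integral {c..d} (\<lambda>s. f (x - s))"
    using set_borel_integral_eq_integral(2)[OF bounded_borel_on_Icc[of "\<lambda>s. f (x - s)" c d B]] bd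
    by (auto simp: set_lebesgue_integral_def)
  finally show ?thesis ..
qed

lemma integral_translate:
  fixes f :: "real \<Rightarrow> real"
  assumes [measurable]: "f \<in> borel_measurable borel" and bd: "\<And>z. z \<in> {p-t..q-t} \<Longrightarrow> \<bar>f z\<bar> \<le> B"
  shows "integral {p..q} (\<lambda>z. f (z - t)) = integral {p-t..q-t} f"
proof -
  have "integral {p-t..q-t} f = (\<integral>z. indicator {p-t..q-t} z * f z \<partial>lborel)"
    using set_borel_integral_eq_integral(2)[OF bounded_borel_on_Icc[OF assms]]
    by (simp add: set_lebesgue_integral_def)
  also have "\<dots> = (\<integral>s. indicator {p..q} s * f (s - t) \<partial>lborel)"
    by (subst lborel_integral_real_affine[of 1 _ "-t"])
       (auto intro!: Bochner_Integration.integral_cong simp: indicator_def)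
  also have "\<dots> = integral {p..q} (\<lambda>s. f (s - t))"
    using set_borel_integral_eq_integral(2)[OF bounded_borel_on_Icc[of "\<lambda>s. f (s - t)" p q B]] bd
    by (auto simp: set_lebesgue_integral_def)
  finally show ?thesis ..
qed

text \<open>The probability that a sum \<open>S\<^sub>k\<close> of \<open>k\<close> independent uniform steps satisfies
\<open>x - h \<le> S\<^sub>k < x\<close>, by conditioning on the first step.\<close>

primrec window_prob :: "real \<Rightarrow> real \<Rightarrow> real \<Rightarrow> nat \<Rightarrow> real \<Rightarrow> real" where
  "window_prob c d h 0 x = of_bool (0 < x \<and> x \<le> h)"
| "window_prob c d h (Suc k) x = (\<integral>s. window_prob c d h k (x - s) \<partial>unif c d)"

text \<open>Multiplied by the Taylor polynomial \<open>1 + y + y\<^sup>2 / 2\<close>, a lower bound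
  of \<open>exp y\<close>, the right-hand side becomes \<open>1 + y^4 / 4\<close>, hence at least
  1.\<close>

lemma exp_minus_le_quadratic:
  fixes y :: real
  assumes "0 \<le> y"
  shows "exp (- y) \<le> 1 - y + y\<^sup>2 / 2"
proof -
  have "1 \<le> 1 + y^4 / 4" by simp
  also have "\<dots> = (1 - y + y\<^sup>2 / 2) * (1 + y + y\<^sup>2 / 2)"
    by (simp add: field_simps power2_eq_square power4_eq_xxxx)
  also have "\<dots> \<le> (1 - y + y\<^sup>2 / 2) * exp y"
  proof (rule mult_left_mono[OF exp_lower_Taylor_quadratic[OF assms]])
    have "0 \<le> (1 - y)\<^sup>2 / 2 + 1 / 2" by simp
    also have "\<dots> = 1 - y + y\<^sup>2 / 2" by (simp add: power2_eq_square field_simps)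
    finally show "0 \<le> 1 - y + y\<^sup>2 / 2" .
  qed
  finally show ?thesis by (simp add: exp_minus field_simps)
qed

text \<open>In use \<open>h\<close> is the weight \<open>t\<close> of the extremal agent, and
  \<open>[c, d]\<close> is \<open>[a, t]\<close> or \<open>[t, b]\<close>. With \<open>c = 0\<close>
  the steps have no positive lower bound; exponential moments then limit the number of sums below
  \<open>x\<close>.\<close>

locale uniform_renewal =
  fixes c d h :: real
  assumes c_nonneg: "0 \<le> c" and c_less_d: "c < d" and h_nonneg: "0 \<le> h"
begin

sublocale X: prob_space "unif c d"
  by (rule prob_space_unif[OF c_less_d])

abbreviation "u \<equiv> window_prob c d h"

lemma u_measurable [measurable]: "u k \<in> borel_measurable borel"
proof (induction k)
  case 0
  then show ?case by simp
next
  case (Suc k)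
  note [measurable] = Suc
  show ?case by simp
qed

lemma u_bounds: "0 \<le> u k x \<and> u k x \<le> 1"
proof (induction k arbitrary: x)
  case (Suc k)
  have "integrable (unif c d) (\<lambda>s. u k (x - s))"
    using Suc by (intro integrable_unif[where B = 1] c_less_d) auto
  then have "(\<integral>s. u k (x - s) \<partial>unif c d) \<le> (\<integral>s. 1 \<partial>unif c d)"
    using Suc by (intro integral_mono) auto
  then show ?case using Suc by (auto simp: X.prob_space[simplified])
qed auto

lemma u_nonneg: "0 \<le> u k x" and u_le_1: "u k x \<le> 1"
  using u_bounds by auto

lemma u_shift_integrable: "integrable (unif c d) (\<lambda>s. u k (x - s))"
  using u_bounds by (intro integrable_unif[where B = 1] c_less_d) auto

lemma u_nonpos: "x \<le> 0 \<Longrightarrow> u k x = 0"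
proof (induction k arbitrary: x)
  case (Suc k)
  have "AE s in unif c d. u k (x - s) = 0"
    using AE_unif[OF c_less_d] by eventually_elim (use Suc c_nonneg in auto)
  then show ?case by (simp add: integral_eq_zero_AE)
qed auto

section \<open>Exponential moments and lower tails of the partial sums\<close>

definition "mgf \<theta> = (\<integral>s. exp (- (\<theta> * s)) \<partial>unif c d)"

lemma integrable_exp: "integrable (unif c d) (\<lambda>s. exp (- (\<theta> * s)))"
proof (rule integrable_unif[OF c_less_d, where B = "exp (\<bar>\<theta>\<bar> * d)"])
  fix s assume "s \<in> {c..d}"
  then have "\<bar>\<theta> * s\<bar> \<le> \<bar>\<theta>\<bar> * d"
    unfolding abs_mult using c_nonneg by (intro mult_left_mono) auto
  then show "\<bar>exp (- (\<theta> * s))\<bar> \<le> exp (\<bar>\<theta>\<bar> * d)" by simp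
qed auto

lemma mgf_nonneg: "0 \<le> mgf \<theta>"
  unfolding mgf_def by simp

text \<open>Markov's inequality for the event \<open>S\<^sub>k < x\<close>, carried along the
  recursion: each step contributes one factor \<open>mgf \<theta>\<close>, the Laplace transform of
  the step.\<close>

lemma u_le_exp: 
  assumes "0 \<le> \<theta>"
  shows "u k x \<le> exp (\<theta> * x) * mgf \<theta> ^ k"
proof (induction k arbitrary: x)
  case 0
  show ?case using assms by auto
next
  case (Suc k)
  have "u (Suc k) x \<le> (\<integral>s. exp (\<theta> * x) * mgf \<theta> ^ k * exp (- (\<theta> * s)) \<partial>unif c d)"
    unfolding window_prob.simps
  proof (rule integral_mono[OF u_shift_integrable])
    fix s
    have "exp (\<theta> * (x - s)) = exp (\<theta> * x) * exp (- (\<theta> * s))"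
      by (simp add: exp_add[symmetric] algebra_simps)
    then show "u k (x - s) \<le> exp (\<theta> * x) * mgf \<theta> ^ k * exp (- (\<theta> * s))"
      using Suc[of "x - s"] by (simp add: mult_ac)
  qed (use integrable_exp in auto)
  then show ?case by (simp add: mgf_def mult_ac)
qed

lemma mean_eq: "(\<integral>s. s \<partial>unif c d) = (c + d) / 2"
  using mean_unif_eq[OF c_less_d] by (simp add: mean_unif_def)

text \<open>The quadratic Taylor bound is integrated, with \<open>d\<^sup>2\<close> in place of the
  second moment.\<close>

lemma mgf_le:
  assumes "0 \<le> \<theta>"
  shows "mgf \<theta> \<le> exp (- \<theta> * ((c + d) / 2) + \<theta>\<^sup>2 * d\<^sup>2 / 2)"
proof -
  have int: "integrable (unif c d) (\<lambda>s. s)"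
    using c_nonneg by (intro integrable_unif[where B = d] c_less_d) auto
  have "mgf \<theta> \<le> (\<integral>s. (1 + \<theta>\<^sup>2 * d\<^sup>2 / 2) - \<theta> * s \<partial>unif c d)"
    unfolding mgf_def
  proof (rule integral_mono_AE[OF integrable_exp])
    show "AE s in unif c d. exp (- (\<theta> * s)) \<le> (1 + \<theta>\<^sup>2 * d\<^sup>2 / 2) - \<theta> * s"
      using AE_unif[OF c_less_d]
    proof eventually_elim
      case (elim s)
      then have "0 \<le> \<theta> * s" and "\<theta> * s \<le> \<theta> * d"
        using assms c_nonneg by (auto intro: mult_left_mono)
      then have "(\<theta> * s)\<^sup>2 \<le> (\<theta> * d)\<^sup>2" by (intro power_mono)
      then show ?case using exp_minus_le_quadratic[OF \<open>0 \<le> \<theta> * s\<close>]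
        by (simp add: power_mult_distrib)
    qed
  qed (use int in auto)
  also have "\<dots> = 1 + (- \<theta> * ((c + d) / 2) + \<theta>\<^sup>2 * d\<^sup>2 / 2)"
    using int by (simp add: mean_eq X.prob_space[simplified])
  also have "\<dots> \<le> exp (- \<theta> * ((c + d) / 2) + \<theta>\<^sup>2 * d\<^sup>2 / 2)"
    by (rule exp_ge_add_one_self)
  finally show ?thesis .
qed

lemma mgf_le_half:
  assumes "0 \<le> \<theta>" "\<theta> * d\<^sup>2 \<le> (c + d) / 2"
  shows "mgf \<theta> \<le> exp (- \<theta> * ((c + d) / 2) / 2)"
proof -
  have "\<theta> * (\<theta> * d\<^sup>2) \<le> \<theta> * ((c + d) / 2)" using assms by (intro mult_left_mono)
  then have "- \<theta> * ((c + d) / 2) + \<theta>\<^sup>2 * d\<^sup>2 / 2 \<le> - \<theta> * ((c + d) / 2) / 2"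
    by (simp add: power2_eq_square)
  then show ?thesis using mgf_le[OF assms(1)] by (meson exp_le_cancel_iff order_trans)
qed

lemma ex_mgf_less_1: "\<exists>\<theta>>0. mgf \<theta> < 1"
proof -
  have d: "0 < d" using c_nonneg c_less_d by simp
  \<comment> \<open>The largest value to which \<open>mgf_le_half\<close> applies.\<close>
  let ?\<theta> = "(c + d) / 2 / d\<^sup>2"
  have "?\<theta> > 0" using d c_nonneg by simp
  moreover have "mgf ?\<theta> \<le> exp (- ?\<theta> * ((c + d) / 2) / 2)"
    using \<open>?\<theta> > 0\<close> d by (intro mgf_le_half) (simp_all)
  moreover have "\<dots> < 1"
  proof -
    have "0 < ?\<theta> * ((c + d) / 2)" using \<open>?\<theta> > 0\<close> d c_nonneg by (intro mult_pos_pos) auto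
    then show ?thesis by (simp only: exp_less_one_iff minus_mult_left[symmetric]) simp
  qed
  ultimately show ?thesis by (metis le_less_trans)
qed

section \<open>The renewal function of a window\<close>

definition "G x = (\<Sum>k. u k x)"

lemma u_summable: "summable (\<lambda>k. u k x)"
proof -
  obtain \<theta> where "\<theta> > 0" "mgf \<theta> < 1" using ex_mgf_less_1 by auto
  show ?thesis
  proof (rule summable_comparison_test')
    show "summable (\<lambda>k. exp (\<theta> * x) * mgf \<theta> ^ k)"
      using \<open>mgf \<theta> < 1\<close> mgf_nonneg by (intro summable_mult summable_geometric) auto
    show "norm (u k x) \<le> exp (\<theta> * x) * mgf \<theta> ^ k" for k
      using u_le_exp[of \<theta> k x] u_nonneg \<open>\<theta> > 0\<close> by simp
  qed
qed

lemma tail_le: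
  assumes "0 \<le> \<theta>" "mgf \<theta> < 1"
  shows "\<bar>(\<Sum>k<n. u k x) - G x\<bar> \<le> exp (\<theta> * x) * mgf \<theta> ^ n / (1 - mgf \<theta>)"
proof -
  have "G x - (\<Sum>k<n. u k x) = (\<Sum>k. u (k + n) x)"
    unfolding G_def by (simp add: suminf_split_initial_segment[OF u_summable, of x n])
  moreover have "0 \<le> (\<Sum>k. u (k + n) x)"
    using u_nonneg by (intro suminf_nonneg summable_ignore_initial_segment[OF u_summable]) auto
  moreover have "u (k + n) x \<le> exp (\<theta> * x) * mgf \<theta> ^ n * mgf \<theta> ^ k" for k
    using u_le_exp[OF assms(1), of "k + n" x] by (simp add: power_add mult_ac)
  then have "(\<Sum>k. u (k + n) x) \<le> (\<Sum>k. exp (\<theta> * x) * mgf \<theta> ^ n * mgf \<theta> ^ k)"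
    using assms mgf_nonneg[of \<theta>]
    by (intro suminf_le summable_mult summable_geometric summable_ignore_initial_segment[OF u_summable]) auto
  moreover have "\<dots> = exp (\<theta> * x) * mgf \<theta> ^ n / (1 - mgf \<theta>)"
    using assms mgf_nonneg[of \<theta>] by (subst suminf_mult) (auto simp: suminf_geometric summable_geometric)
  ultimately show ?thesis by linarith
qed

lemma G_nonneg: "0 \<le> G x"
  unfolding G_def using u_nonneg u_summable by (intro suminf_nonneg)

lemma G_nonpos: "x \<le> 0 \<Longrightarrow> G x = 0"
  unfolding G_def by (simp add: u_nonpos)

lemma G_measurable [measurable]: "G \<in> borel_measurable borel"
  unfolding G_def[abs_def] by measurable

text \<open>A provisional bound: it grows with \<open>x\<close>, but it makes \<open>G\<close>
  integrable on bounded intervals, from which the uniform bound \<open>G_le\<close> is derived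
  later.\<close>

lemma G_le_exp: "\<exists>\<theta> C. 0 \<le> \<theta> \<and> (\<forall>x. G x \<le> C * exp (\<theta> * x))"
proof -
  obtain \<theta> where "\<theta> > 0" "mgf \<theta> < 1" using ex_mgf_less_1 by auto
  \<comment> \<open>For \<open>n = 0\<close> the partial sum in \<open>tail_le\<close> is empty, and
    the tail is all of \<open>G x\<close>.\<close>
  then have "G x \<le> 1 / (1 - mgf \<theta>) * exp (\<theta> * x)" for x
    using tail_le[where \<theta> = \<theta> and n = 0 and x = x] G_nonneg[of x] by simp
  then show ?thesis using \<open>\<theta> > 0\<close> by (meson less_imp_le)
qed

lemma G_bounded_on: "\<exists>B. \<forall>x\<le>T. \<bar>G x\<bar> \<le> B"
proof -
  obtain \<theta> C where "0 \<le> \<theta>" and C: "\<And>x. G x \<le> C * exp (\<theta> * x)" using G_le_exp by auto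
  have "C \<ge> 0" using C[of 0] G_nonneg[of 0] by simp
  have "\<bar>G x\<bar> \<le> C * exp (\<theta> * T)" if "x \<le> T" for x
  proof -
    have "C * exp (\<theta> * x) \<le> C * exp (\<theta> * T)"
      using that \<open>0 \<le> \<theta>\<close> \<open>C \<ge> 0\<close> by (intro mult_left_mono) (auto intro: mult_left_mono)
    then show ?thesis using C[of x] G_nonneg[of x] by simp
  qed
  then show ?thesis by blast
qed

lemma G_integrable_on: "G integrable_on {p..q}"
proof -
  obtain B where "\<forall>x\<le>q. \<bar>G x\<bar> \<le> B" using G_bounded_on by blast
  then show ?thesis by (intro integrable_on_Icc_borel[where B = B]) auto
qed

text \<open>Conditioning on the first step: \<open>u 0\<close> accounts for the empty sum, and the
  other terms reproduce the series. Sum and integral commute because the terms are nonnegative with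
  a convergent total.\<close>

lemma G_renewal: "G x = u 0 x + (\<integral>s. G (x - s) \<partial>unif c d)"
proof -
  have "(\<integral>s. (\<Sum>k. u k (x - s)) \<partial>unif c d) = (\<Sum>k. \<integral>s. u k (x - s) \<partial>unif c d)"
  proof (rule integral_suminf[OF u_shift_integrable])
    show "AE s in unif c d. summable (\<lambda>k. norm (u k (x - s)))"
      using u_summable u_nonneg by simp
    have "summable (\<lambda>k. u (Suc k) x)"
      using u_summable[of x] by (subst summable_Suc_iff)
    then show "summable (\<lambda>k. \<integral>s. norm (u k (x - s)) \<partial>unif c d)"
      using u_nonneg by simp
  qed
  then have "(\<integral>s. G (x - s) \<partial>unif c d) = (\<Sum>k. u (Suc k) x)"
    by (simp add: G_def)
  then show ?thesis unfolding G_def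
    using suminf_split_head[OF u_summable[of x]] by simp
qed

section \<open>The integrated renewal function\<close>

definition "H x = integral {0..x} G"

lemma H_nonpos: "x \<le> 0 \<Longrightarrow> H x = 0"
  by (cases "x = 0") (auto simp: H_def)

lemma H_diff:
  assumes "p \<le> q"
  shows "integral {p..q} G = H q - H p"
proof (cases "0 \<le> p")
  case True
  then show ?thesis
    using Henstock_Kurzweil_Integration.integral_combine[of 0 p q G] G_integrable_on assms by (simp add: H_def)
next
  case False
  have z: "integral {p'..q'} G = 0" if "q' \<le> 0" for p' q'
    using that G_nonpos by (subst integral_cong[of _ _ "\<lambda>_. 0"]) auto
  show ?thesis
  proof (cases "0 \<le> q")
    case True
    then show ?thesis
      using Henstock_Kurzweil_Integration.integral_combine[of p 0 q G] G_integrable_on False z[of 0 p] H_nonpos[of p]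
      by (simp add: H_def)
  next
    case False
    then show ?thesis using z[of q p] H_nonpos[of p] H_nonpos[of q] assms by simp
  qed
qed

lemma H_mono: "p \<le> q \<Longrightarrow> H p \<le> H q"
  using H_diff[of p q] integral_nonneg[OF G_integrable_on, of p q] G_nonneg by simp

lemma H_measurable [measurable]: "H \<in> borel_measurable borel"
  by (intro borel_measurable_mono monoI H_mono)

lemma H_nonneg: "0 \<le> H x"
  using H_mono[of 0 x] H_nonpos[of 0] H_nonpos[of x] by linarith

lemma H_abs_le: "x \<le> q \<Longrightarrow> \<bar>H x\<bar> \<le> H q"
  using H_mono H_nonneg by simp

lemma H_integrable_on: "H integrable_on {p..q}"
  using H_abs_le by (intro integrable_on_Icc_borel[where B = "H q"]) auto

lemma G_eq: "G x = u 0 x + integral {x-d..x-c} G / (d - c)"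
proof -
  obtain B where B: "\<And>z. z \<le> x - c \<Longrightarrow> \<bar>G z\<bar> \<le> B" using G_bounded_on by blast
  have "(\<integral>s. G (x - s) \<partial>unif c d) = integral {c..d} (\<lambda>s. G (x - s)) / (d - c)"
    by (rule integral_unif[where B = B]) (use c_less_d B in auto)
  also have "integral {c..d} (\<lambda>s. G (x - s)) = integral {x-d..x-c} G"
    by (rule integral_reflect_shift[where B = B]) (use B in auto)
  finally show ?thesis using G_renewal[of x] by linarith
qed

lemma G_eq_H: "G x = u 0 x + (H (x - c) - H (x - d)) / (d - c)"
  using G_eq[of x] H_diff[of "x - d" "x - c"] c_less_d by simp

lemma integral_u0:
  assumes "0 \<le> x"
  shows "integral {0..x} (u 0) = min x h" and "u 0 integrable_on {0..x}"
proof -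
  have bd: "\<bar>u 0 z\<bar> \<le> 1" for z by simp
  have "(LINT z:{0..x}|lborel. u 0 z) = (\<integral>z. indicator {0<..min x h} z \<partial>lborel)"
    unfolding set_lebesgue_integral_def
    by (intro Bochner_Integration.integral_cong) (auto simp: indicator_def)
  also have "\<dots> = min x h" using assms h_nonneg by simp
  finally show "integral {0..x} (u 0) = min x h"
    using set_borel_integral_eq_integral(2)[OF bounded_borel_on_Icc[of "u 0" 0 x 1]] bd by simp
  show "u 0 integrable_on {0..x}"
    by (rule integrable_on_Icc_borel[where B = 1]) (use bd in auto)
qed

text \<open>The integrated renewal equation is what identifies the limit of \<open>G\<close>.\<close>

lemma H_eq:
  assumes "0 \<le> x"
  shows "H x = min x h + integral {x-d..x-c} H / (d - c)"
proof -
  have zero: "integral {p..q} H = 0" if "q \<le> 0" for p q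
    using that H_nonpos by (subst integral_cong[of _ _ "\<lambda>_. 0"]) auto
  have int: "(\<lambda>z. H (z - t)) integrable_on {0..x}" for t
    using H_abs_le by (intro integrable_on_Icc_borel[where B = "H (x - t)"]) auto
  have tr: "integral {0..x} (\<lambda>z. H (z - t)) = integral {0-t..x-t} H" for t
    using H_abs_le by (intro integral_translate[where B = "H (x - t)"]) auto
  have "H x = integral {0..x} (\<lambda>z. u 0 z + (H (z - c) - H (z - d)) / (d - c))"
    unfolding H_def[of x] using G_eq_H by (intro integral_cong) auto
  also have "\<dots> = integral {0..x} (u 0) + integral {0..x} (\<lambda>z. (H (z - c) - H (z - d)) / (d - c))"
    using int integral_u0(2)[OF assms]
    by (intro Henstock_Kurzweil_Integration.integral_add integrable_on_divide Henstock_Kurzweil_Integration.integrable_diff)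
  also have "integral {0..x} (\<lambda>z. (H (z - c) - H (z - d)) / (d - c))
      = integral {0..x} (\<lambda>z. H (z - c) - H (z - d)) / (d - c)"
    by (rule integral_divide)
  also have "integral {0..x} (\<lambda>z. H (z - c) - H (z - d)) = integral {0-c..x-c} H - integral {0-d..x-d} H"
    using int tr by (subst Henstock_Kurzweil_Integration.integral_diff) auto
  \<comment> \<open>The first integral may start at \<open>- d\<close> as well, because
    \<open>H\<close> vanishes below 0; the common part up to \<open>x - d\<close> then
    cancels.\<close>
  also have "\<dots> = integral {x-d..x-c} H"
    using Henstock_Kurzweil_Integration.integral_combine[of "-d" "-c" "x-c" H]
      Henstock_Kurzweil_Integration.integral_combine[of "-d" "x-d" "x-c" H]
      zero[of "-c" "-d"] H_integrable_on c_nonneg c_less_d assms by auto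
  finally show ?thesis using integral_u0(1)[OF assms] by (simp only:)
qed

end

section \<open>Geometric convergence of the renewal function\<close>

text \<open>Trimming by \<open>\<kappa>\<close> at both ends keeps the bound within a factor 16, and the interval still grows by
\<open>7/8 (d - c)\<close> per step, so that it eventually exceeds the averaging window.\<close>

lemma averaging_spread_step:
  fixes v :: "real \<Rightarrow> real"
  assumes "0 \<le> c" "c < d"
    and int: "\<And>p q. v integrable_on {p..q}"
    and nonneg: "\<And>x. T \<le> x \<Longrightarrow> 0 \<le> v x"
    and avg: "\<And>x. T + d \<le> x \<Longrightarrow> v x = integral {x-d..x-c} v / (d - c)"
    and \<kappa>: "\<kappa> = (d - c) / 16" "\<kappa> \<le> l" and "T + d \<le> y"
    and base: "\<And>z. z \<in> {y..y+l} \<Longrightarrow> e \<le> v z"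
    and x: "x \<in> {y + (c + \<kappa>)..y + l + (d - \<kappa>)}" and "0 \<le> e"
  shows "e / 16 \<le> v x"
proof -
  \<comment> \<open>The part of the averaging window \<open>[x - d, x - c]\<close> that lies in the
    base interval. Its length is at least \<open>\<kappa>\<close>, a sixteenth of the window, whence
    the loss of a factor 16.\<close>
  define p q where "p = max (x - d) y" and "q = min (x - c) (y + l)"
  have pq: "\<kappa> \<le> q - p" "x - d \<le> p" "q \<le> x - c" "y \<le> p" "q \<le> y + l"
  proof -
    have "16 * \<kappa> = d - c" using \<kappa>(1) by simp
    moreover have "y + (c + \<kappa>) \<le> x" "x \<le> y + l + (d - \<kappa>)" using x by auto
    ultimately show "\<kappa> \<le> q - p" "x - d \<le> p" "q \<le> x - c" "y \<le> p" "q \<le> y + l"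
      using \<kappa>(2) \<open>c < d\<close> unfolding p_def q_def by linarith+
  qed
  have "e * \<kappa> \<le> e * (q - p)" using pq \<open>0 \<le> e\<close> by (intro mult_left_mono)
  also have "\<dots> = integral {p..q} (\<lambda>_. e)" using pq \<kappa> \<open>c < d\<close> by simp
  also have "\<dots> \<le> integral {p..q} v"
    using pq base by (intro integral_le int) auto
  also have "\<dots> \<le> integral {x-d..x-c} v"
  proof (intro integral_subset_le int ballI nonneg)
    fix z assume "z \<in> {x-d..x-c}"
    moreover have "y + (c + \<kappa>) \<le> x" using x by simp
    moreover have "0 < \<kappa>" using \<kappa>(1) \<open>c < d\<close> by simp
    ultimately show "T \<le> z" using \<open>0 \<le> c\<close> \<open>T + d \<le> y\<close> unfolding atLeastAtMost_iff by linarith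
  qed (use pq in auto)
  finally have "e * \<kappa> / (d - c) \<le> integral {x-d..x-c} v / (d - c)"
    using \<open>c < d\<close> by (intro divide_right_mono) auto
  moreover have "v x = integral {x-d..x-c} v / (d - c)"
  proof (rule avg)
    have "y + (c + \<kappa>) \<le> x" using x by simp
    moreover have "0 < \<kappa>" using \<kappa>(1) \<open>c < d\<close> by simp
    ultimately show "T + d \<le> x" using \<open>0 \<le> c\<close> \<open>T + d \<le> y\<close> by linarith
  qed
  moreover have "e * \<kappa> / (d - c) = e / 16" unfolding \<kappa>(1) using \<open>c < d\<close> by (simp add: field_simps)
  ultimately show ?thesis by simp
qed

text \<open>The step can be repeated on the interval reached so far: that interval has grown by
  \<open>d - c - 2 * \<kappa>\<close>, so the requirement \<open>\<kappa> \<le> l\<close>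
  persists.\<close>

lemma averaging_spread:
  fixes v :: "real \<Rightarrow> real"
  assumes "0 \<le> c" "c < d"
    and int: "\<And>p q. v integrable_on {p..q}"
    and nonneg: "\<And>x. T \<le> x \<Longrightarrow> 0 \<le> v x"
    and avg: "\<And>x. T + d \<le> x \<Longrightarrow> v x = integral {x-d..x-c} v / (d - c)"
    and \<kappa>: "\<kappa> = (d - c) / 16" "\<kappa> \<le> l" and "T + d \<le> y"
    and base: "\<And>z. z \<in> {y..y+l} \<Longrightarrow> e \<le> v z" and "0 \<le> e"
  shows "x \<in> {y + m * (c + \<kappa>)..y + l + m * (d - \<kappa>)} \<Longrightarrow> e / 16 ^ m \<le> v x"
proof (induction m arbitrary: x)
  case 0
  then show ?case using base by auto
next
  case (Suc m)
  define y' l' where "y' = y + m * (c + \<kappa>)" and "l' = l + m * (d - c - 2 * \<kappa>)"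
  have end_eq: "y' + l' = y + l + m * (d - \<kappa>)" by (simp add: y'_def l'_def algebra_simps)
  have "0 \<le> real m * (d - c - 2 * \<kappa>)" "0 \<le> real m * (c + \<kappa>)"
    using \<kappa> assms(1,2) by auto
  then have "\<kappa> \<le> l'" "T + d \<le> y'" using \<kappa>(2) \<open>T + d \<le> y\<close> by (auto simp: y'_def l'_def)
  have "e / 16 ^ m / 16 \<le> v x"
  proof (rule averaging_spread_step[OF assms(1-3) nonneg avg \<kappa>(1) \<open>\<kappa> \<le> l'\<close> \<open>T + d \<le> y'\<close>])
    show "e / 16 ^ m \<le> v z" if "z \<in> {y'..y'+l'}" for z
      using that Suc.IH[of z] unfolding end_eq by (simp add: y'_def)
    show "x \<in> {y' + (c + \<kappa>)..y' + l' + (d - \<kappa>)}"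
      using Suc.prems unfolding end_eq by (simp add: y'_def algebra_simps)
  qed (use \<open>0 \<le> e\<close> in auto)
  then show ?case by simp
qed

text \<open>One large value becomes a lower bound at all later points. Shifting the averaging window
  by \<open>\<delta>\<close> loses mass at most \<open>2 * M * \<delta>\<close>, so \<open>v\<close>
  cannot fall fast and is at least \<open>M / 2\<close> on a whole interval to the right of a point
  with \<open>3 * M / 4 \<le> v z\<close>. Spreading this interval \<open>m\<close> times reaches
  \<open>x\<close>.\<close>

lemma averaging_lower_bound:
  fixes v :: "real \<Rightarrow> real"
  assumes "0 \<le> c" "c < d"
    and int: "\<And>p q. v integrable_on {p..q}"
    and nonneg: "\<And>x. T \<le> x \<Longrightarrow> 0 \<le> v x" and upper: "\<And>x. T \<le> x \<Longrightarrow> v x \<le> 2 * M"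
    and avg: "\<And>x. T + d \<le> x \<Longrightarrow> v x = integral {x-d..x-c} v / (d - c)"
    and m: "2 * d \<le> m * (d - c)"
    and large: "\<And>w. T + 2 * d \<le> w \<Longrightarrow> \<exists>z\<in>{w-d..w}. 3 * M / 4 \<le> v z"
    and x: "T + (real m + 3) * d \<le> x"
  shows "M / (2 * 16 ^ m) \<le> v x"
proof -
  have "0 \<le> d" using assms by simp
  define \<kappa> where "\<kappa> = (d - c) / 16"
  have "0 < \<kappa>" using \<open>c < d\<close> by (simp add: \<kappa>_def)
  have "0 \<le> M" using nonneg[of T] upper[of T] by simp
  \<comment> \<open>The point from which \<open>m\<close> steps of the minimal size
    \<open>c + \<kappa>\<close> lead to \<open>x\<close>. In the hypothesis on \<open>x\<close>, the
    part \<open>m * d\<close> pays for these steps, and \<open>3 * d\<close> for the search of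
    \<open>z\<close> and the averaging windows before it.\<close>
  define w where "w = x - m * (c + \<kappa>)"
  have "m * (c + \<kappa>) \<le> m * d" using \<open>c < d\<close> by (intro mult_left_mono) (auto simp: \<kappa>_def field_simps)
  then have "T + 3 * d \<le> w" using x by (simp add: w_def algebra_simps)
  then obtain z where z: "z \<in> {w-d..w}" "3 * M / 4 \<le> v z"
    using large[of w] \<open>0 \<le> d\<close> by auto
  have Tz: "T + 2 * d \<le> z" using z \<open>T + 3 * d \<le> w\<close> by auto
  have base: "M / 2 \<le> v z'" if z': "z' \<in> {z..z + (d - c) / 8}" for z'
  proof -
    \<comment> \<open>A shift by at most \<open>(d - c) / 8\<close> changes the average by at most
      \<open>2 * M / 8 = M / 4\<close>.\<close>
    define \<delta> where "\<delta> = z' - z"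
    have \<delta>: "0 \<le> \<delta>" "\<delta> \<le> (d - c) / 8" using z' unfolding \<delta>_def atLeastAtMost_iff by linarith+
    have "integral {z-d..z-c} v = integral {z-d..z-d+\<delta>} v + integral {z-d+\<delta>..z-c} v"
      using \<delta> \<open>c < d\<close>
      by (intro Henstock_Kurzweil_Integration.integral_combine[symmetric] int) auto
    also have "integral {z-d..z-d+\<delta>} v \<le> integral {z-d..z-d+\<delta>} (\<lambda>_. 2 * M)"
      using Tz \<open>0 \<le> d\<close> by (intro integral_le int upper) auto
    also have "\<dots> = 2 * M * \<delta>" using \<delta> by simp
    also have "integral {z-d+\<delta>..z-c} v \<le> integral {z'-d..z'-c} v"
      using \<delta> Tz \<open>0 \<le> d\<close> by (intro integral_subset_le int nonneg) (auto simp: \<delta>_def intro!: nonneg)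
    finally have "integral {z-d..z-c} v \<le> 2 * M * \<delta> + integral {z'-d..z'-c} v" by simp
    also have "2 * M * \<delta> \<le> 2 * M * ((d - c) / 8)"
      using \<delta> \<open>0 \<le> M\<close> by (intro mult_left_mono) auto
    finally have "integral {z-d..z-c} v / (d - c) \<le> (M * (d - c) / 4 + integral {z'-d..z'-c} v) / (d - c)"
      using \<open>c < d\<close> by (intro divide_right_mono) auto
    also have "\<dots> = M / 4 + integral {z'-d..z'-c} v / (d - c)"
      using \<open>c < d\<close> by (simp add: field_simps)
    finally have "v z \<le> M / 4 + v z'"
      using avg[of z] avg[of z'] Tz z' \<open>0 \<le> d\<close> by auto
    then show ?thesis using z by simp
  qed
  have "M / 2 / 16 ^ m \<le> v x"
  proof (rule averaging_spread[OF assms(1-3) nonneg avg \<kappa>_def])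
    show "\<kappa> \<le> (d - c) / 8" using \<open>c < d\<close> by (simp add: \<kappa>_def)
    show "T + d \<le> z" using Tz \<open>0 \<le> d\<close> by simp
    have zw: "w - d \<le> z" "z \<le> w" using z by auto
    have xw: "x = w + m * (c + \<kappa>)" by (simp add: w_def)
    \<comment> \<open>The position of \<open>z\<close> is known only up to \<open>d\<close>, so the
      reached interval must have grown by at least \<open>d\<close>; the condition on
      \<open>m\<close> gives growth \<open>7/8 * (2 * d)\<close>.\<close>
    have dm: "d + m * (c + \<kappa>) \<le> m * (d - \<kappa>)"
    proof -
      have "d \<le> m * (d - c) * (7 / 8)" using m \<open>0 \<le> d\<close> by simp
      also have "\<dots> = m * (d - \<kappa>) - m * (c + \<kappa>)" by (simp add: \<kappa>_def field_simps)
      finally show ?thesis by simp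
    qed
    have "z + m * (c + \<kappa>) \<le> x" using xw zw by simp
    moreover have "x \<le> z + (d - c) / 8 + m * (d - \<kappa>)"
    proof -
      have "x \<le> z + (d + m * (c + \<kappa>))" using xw zw by simp
      also have "\<dots> \<le> z + m * (d - \<kappa>)" using dm by simp
      finally have "x \<le> z + m * (d - \<kappa>)" .
      moreover have "0 \<le> (d - c) / 8" using \<open>c < d\<close> by simp
      ultimately show ?thesis by linarith
    qed
    ultimately show "x \<in> {z + m * (c + \<kappa>)..z + (d - c) / 8 + m * (d - \<kappa>)}" by simp
  qed (use base \<open>0 \<le> M\<close> in auto)
  then show ?thesis by simp
qed

section \<open>Oscillation of the renewal function around its limit\<close>

context uniform_renewal
begin

definition "L = 2 * h / (c + d)"

lemma cd_pos: "0 < c + d"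
  using c_nonneg c_less_d by simp

lemma L_nonneg: "0 \<le> L"
  using h_nonneg cd_pos by (simp add: L_def)

text \<open>The value that the integral of \<open>H x - H z\<close> over the averaging window would
  have if \<open>G\<close> were constantly \<open>k\<close>.\<close>

lemma integral_linear_window: "integral {x-d..x-c} (\<lambda>z. k * (x - z)) = k * ((c + d) / 2) * (d - c)"
proof -
  have "((\<lambda>z. k * (x - z)) has_integral (- k * (x - (x - c))\<^sup>2 / 2 - (- k * (x - (x - d))\<^sup>2 / 2))) {x-d..x-c}"
    using c_less_d
    by (intro fundamental_theorem_of_calculus)
       (auto intro!: derivative_eq_intros simp: field_simps simp flip: has_real_derivative_iff_has_vector_derivative)
  then show ?thesis by (simp add: integral_unique power2_eq_square field_simps)
qed

lemma linear_integrable_on: "(\<lambda>z. k * (x - z)) integrable_on {p..q :: real}"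
  by (intro integrable_continuous_interval continuous_intros)

lemma H_diff_integrable_on: "(\<lambda>z. H x - H z) integrable_on {p..q}"
  using H_integrable_on by (auto intro!: Henstock_Kurzweil_Integration.integrable_diff)

text \<open>A conserved quantity: by the integrated renewal equation, \<open>H x - H (x - s)\<close>
  averaged over the step \<open>s\<close> equals \<open>h\<close> once \<open>x\<close> has passed
  the initial window. Comparison with a constant \<open>G\<close> singles out \<open>L\<close>,
  which is \<open>h\<close> divided by the mean step.\<close>

lemma integral_H_window:
  assumes "h \<le> x"
  shows "integral {x-d..x-c} (\<lambda>z. H x - H z) = h * (d - c)"
proof -
  have "integral {x-d..x-c} (\<lambda>z. H x - H z) = (d - c) * H x - integral {x-d..x-c} H"
    using c_less_d H_integrable_on by (subst Henstock_Kurzweil_Integration.integral_diff) auto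
  also have "\<dots> = h * (d - c)"
    using H_eq[of x] assms h_nonneg c_less_d by (simp add: field_simps)
  finally show ?thesis .
qed

text \<open>If \<open>G\<close> stays above \<open>k\<close>, then \<open>H\<close> grows at least
  like a line of slope \<open>k\<close>, and the conserved quantity is at least \<open>k\<close>
  times the mean step.\<close>

lemma window_lower_le_L:
  assumes "h \<le> x" and ge: "\<And>z. z \<in> {x-d..x} \<Longrightarrow> k \<le> G z"
  shows "k \<le> L"
proof -
  have "k * ((c + d) / 2) * (d - c) = integral {x-d..x-c} (\<lambda>z. k * (x - z))"
    by (simp only: integral_linear_window)
  also have "\<dots> \<le> integral {x-d..x-c} (\<lambda>z. H x - H z)"
  proof (rule integral_le)
    fix z assume z: "z \<in> {x-d..x-c}"
    then have "k * (x - z) = integral {z..x} (\<lambda>_. k)" using c_nonneg by simp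
    also have "\<dots> \<le> integral {z..x} G" using z ge by (intro integral_le G_integrable_on) auto
    also have "\<dots> = H x - H z" using z c_nonneg by (intro H_diff) auto
    finally show "k * (x - z) \<le> H x - H z" .
  qed (intro linear_integrable_on H_diff_integrable_on)+
  also have "\<dots> = h * (d - c)" by (rule integral_H_window) fact
  finally have "k * ((c + d) / 2) \<le> h" using c_less_d by (simp only: mult_le_cancel_right)
  then show ?thesis using cd_pos by (simp add: L_def field_simps)
qed

lemma window_upper_ge_L:
  assumes "h \<le> x" and le: "\<And>z. z \<in> {x-d..x} \<Longrightarrow> G z \<le> k"
  shows "L \<le> k"
proof -
  have "h * (d - c) = integral {x-d..x-c} (\<lambda>z. H x - H z)" by (rule integral_H_window[symmetric]) fact
  also have "\<dots> \<le> integral {x-d..x-c} (\<lambda>z. k * (x - z))"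
  proof (rule integral_le)
    fix z assume z: "z \<in> {x-d..x-c}"
    have "H x - H z = integral {z..x} G" using z c_nonneg by (intro H_diff[symmetric]) auto
    also have "\<dots> \<le> integral {z..x} (\<lambda>_. k)" using z le by (intro integral_le G_integrable_on) auto
    also have "\<dots> = k * (x - z)" using z c_nonneg by simp
    finally show "H x - H z \<le> k * (x - z)" .
  qed (intro linear_integrable_on H_diff_integrable_on)+
  also have "\<dots> = k * ((c + d) / 2) * (d - c)" by (rule integral_linear_window)
  finally have "h \<le> k * ((c + d) / 2)" using c_less_d by (simp only: mult_le_cancel_right)
  then show ?thesis using cd_pos by (simp add: L_def field_simps)
qed

lemma H_le: "H y \<le> h + integral {y-d..y-c} H / (d - c)"
proof (cases "0 \<le> y")
  case True
  then show ?thesis using H_eq[of y] by simp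
next
  case False
  have "0 \<le> integral {y-d..y-c} H / (d - c)"
    using c_less_d by (intro divide_nonneg_nonneg integral_nonneg H_integrable_on H_nonneg) auto
  then show ?thesis using False H_nonpos[of y] h_nonneg by simp
qed

text \<open>The averaging window is split at its midpoint \<open>y - (c + d) / 2\<close>. By
  monotonicity \<open>H\<close> is at most its value there on the left half and at most
  \<open>H y\<close> on the right half, so \<open>H_le\<close> bounds \<open>H y\<close> by
  \<open>h\<close> plus the mean of these two values.\<close>

lemma H_increment_le: "H y - H (y - (c + d) / 2) \<le> 2 * h"
proof -
  let ?\<mu> = "(c + d) / 2"
  have "integral {y-d..y-c} H = integral {y-d..y-?\<mu>} H + integral {y-?\<mu>..y-c} H"
    using c_less_d
    by (intro Henstock_Kurzweil_Integration.integral_combine[symmetric] H_integrable_on)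
       (auto simp: field_simps)
  also have "integral {y-d..y-?\<mu>} H \<le> integral {y-d..y-?\<mu>} (\<lambda>_. H (y - ?\<mu>))"
    by (intro integral_le H_integrable_on H_mono) auto
  also have "integral {y-?\<mu>..y-c} H \<le> integral {y-?\<mu>..y-c} (\<lambda>_. H y)"
    using c_nonneg by (intro integral_le H_integrable_on H_mono) auto
  finally have "integral {y-d..y-c} H \<le> (d - c) / 2 * H (y - ?\<mu>) + (d - c) / 2 * H y"
    using c_less_d by (simp add: field_simps)
  then have "integral {y-d..y-c} H / (d - c) \<le> ((d - c) / 2 * H (y - ?\<mu>) + (d - c) / 2 * H y) / (d - c)"
    using c_less_d by (intro divide_right_mono) auto
  also have "\<dots> = (H (y - ?\<mu>) + H y) / 2"
    using c_less_d by (simp add: field_simps)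
  finally have "h + integral {y-d..y-c} H / (d - c) \<le> h + (H (y - ?\<mu>) + H y) / 2"
    by simp
  with H_le[of y] have "H y \<le> h + (H (y - ?\<mu>) + H y) / 2" by (rule order_trans)
  then show ?thesis by (simp add: field_simps)
qed

text \<open>In contrast to \<open>G_le_exp\<close>, this is uniform in \<open>x\<close> and explicit
  in \<open>h\<close> and \<open>d - c\<close>. Two increments of length \<open>(c + d) / 2\<close>
  cover \<open>[x - d, x - c]\<close>, because \<open>c + d \<ge> d - c\<close>.\<close>

lemma G_le: "G x \<le> 1 + 4 * h / (d - c)"
proof -
  let ?\<mu> = "(c + d) / 2"
  have "H (x - c) - H (x - d) \<le> 4 * h"
    using H_increment_le[of "x - c"] H_increment_le[of "x - c - ?\<mu>"]
      H_mono[of "x - c - ?\<mu> - ?\<mu>" "x - d"] c_nonneg by simp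
  then have "(H (x - c) - H (x - d)) / (d - c) \<le> 4 * h / (d - c)"
    using c_less_d by (intro divide_right_mono) auto
  then show ?thesis using G_eq_H[of x] u_le_1[of 0 x] by linarith
qed

lemma G_avg: "h < x \<Longrightarrow> G x = integral {x-d..x-c} G / (d - c)"
  using G_eq[of x] by simp

text \<open>Both \<open>M - (G - L)\<close> and \<open>M + (G - L)\<close> average themselves and
  take values in \<open>[0, 2 * M]\<close>. Neither can stay below \<open>3 * M / 4\<close> on a
  window, since \<open>G\<close> would then keep a distance of \<open>M / 4\<close> from
  \<open>L\<close> on one side; so \<open>averaging_lower_bound\<close> trims the oscillation from
  above and from below.\<close>

lemma contraction_step:
  assumes "h \<le> T" and m: "2 * d \<le> m * (d - c)" and "0 < M"
    and bd: "\<And>x. T \<le> x \<Longrightarrow> \<bar>G x - L\<bar> \<le> M"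
    and x: "T + (real m + 3) * d \<le> x"
  shows "\<bar>G x - L\<bar> \<le> (1 - 1 / (2 * 16 ^ m)) * M"
proof -
  have "0 < d" using c_nonneg c_less_d by simp
  have int: "(\<lambda>x. M - (G x - L)) integrable_on {p..q}" "(\<lambda>x. M + (G x - L)) integrable_on {p..q}" for p q
    using G_integrable_on by (auto intro!: Henstock_Kurzweil_Integration.integrable_diff
        Henstock_Kurzweil_Integration.integrable_add)
  have "M / (2 * 16 ^ m) \<le> M - (G x - L)"
  proof (rule averaging_lower_bound[OF c_nonneg c_less_d int(1) _ _ _ m _ x])
    fix x assume "T + d \<le> x"
    have "integral {x-d..x-c} (\<lambda>x. M - (G x - L)) = (M + L) * (d - c) - integral {x-d..x-c} G"
      using G_integrable_on c_less_d
        Henstock_Kurzweil_Integration.integral_diff[OF integrable_const_ivl G_integrable_on, of "x-d" "x-c" "M + L"]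
      by (simp add: diff_diff_eq2 mult.commute)
    then show "M - (G x - L) = integral {x-d..x-c} (\<lambda>x. M - (G x - L)) / (d - c)"
      using G_avg[of x] \<open>T + d \<le> x\<close> \<open>0 < d\<close> \<open>h \<le> T\<close> c_less_d by (simp add: field_simps)
  next
    fix w assume w: "T + 2 * d \<le> w"
    show "\<exists>z\<in>{w-d..w}. 3 * M / 4 \<le> M - (G z - L)"
    proof (rule ccontr)
      assume "\<not> ?thesis"
      then have "M - (G z - L) < 3 * M / 4" if "z \<in> {w-d..w}" for z using that by (meson not_le)
      then have "L + M / 4 \<le> G z" if "z \<in> {w-d..w}" for z using that by fastforce
      then have "L + M / 4 \<le> L" using w \<open>h \<le> T\<close> \<open>0 < d\<close> by (intro window_lower_le_L[of w]) auto
      then show False using \<open>0 < M\<close> by simp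
    qed
  qed (use bd in \<open>force simp: abs_le_iff\<close>)+
  moreover have "M / (2 * 16 ^ m) \<le> M + (G x - L)"
  proof (rule averaging_lower_bound[OF c_nonneg c_less_d int(2) _ _ _ m _ x])
    fix x assume "T + d \<le> x"
    have "integral {x-d..x-c} (\<lambda>x. M + (G x - L)) = (M - L) * (d - c) + integral {x-d..x-c} G"
      using G_integrable_on c_less_d
      using Henstock_Kurzweil_Integration.integral_add[OF integrable_const_ivl G_integrable_on, of "x-d" "x-c" "M - L"]
      by (simp add: add_diff_eq diff_add_eq mult.commute)
    then show "M + (G x - L) = integral {x-d..x-c} (\<lambda>x. M + (G x - L)) / (d - c)"
      using G_avg[of x] \<open>T + d \<le> x\<close> \<open>0 < d\<close> \<open>h \<le> T\<close> c_less_d by (simp add: field_simps)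
  next
    fix w assume w: "T + 2 * d \<le> w"
    show "\<exists>z\<in>{w-d..w}. 3 * M / 4 \<le> M + (G z - L)"
    proof (rule ccontr)
      assume "\<not> ?thesis"
      then have "M + (G z - L) < 3 * M / 4" if "z \<in> {w-d..w}" for z using that by (meson not_le)
      then have "G z \<le> L - M / 4" if "z \<in> {w-d..w}" for z using that by fastforce
      then have "L \<le> L - M / 4" using w \<open>h \<le> T\<close> \<open>0 < d\<close> by (intro window_upper_ge_L[of w]) auto
      then show False using \<open>0 < M\<close> by simp
    qed
  qed (use bd in \<open>force simp: abs_le_iff\<close>)+
  ultimately show ?thesis by (simp add: algebra_simps)
qed

lemma G_minus_L_le: "\<bar>G x - L\<bar> \<le> 1 + 4 * h / (d - c) + L"
  using G_le[of x] G_nonneg[of x] L_nonneg c_less_d h_nonneg by (simp add: abs_le_iff)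

text \<open>The global bound \<open>G_minus_L_le\<close> starts the iteration; every block of length
  \<open>(m + 3) * d\<close> beyond \<open>h\<close> gains one contraction factor.\<close>

lemma G_contraction:
  assumes m: "2 * d \<le> m * (d - c)" and "h + j * ((real m + 3) * d) \<le> x"
  shows "\<bar>G x - L\<bar> \<le> (1 - 1 / (2 * 16 ^ m)) ^ j * (1 + 4 * h / (d - c) + L)"
  using assms(2)
proof (induction j arbitrary: x)
  case 0
  then show ?case using G_minus_L_le by simp
next
  case (Suc j)
  let ?r = "1 - 1 / (2 * 16 ^ m) :: real"
  let ?T = "h + j * ((real m + 3) * d)"
  have "2 * 16 ^ m > (1::real)"
    using one_le_power[of "16::real" m] by linarith
  then have r: "0 < ?r" by simp
  have d: "0 < d" using c_nonneg c_less_d by simp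
  have "\<bar>G x - L\<bar> \<le> ?r * (?r ^ j * (1 + 4 * h / (d - c) + L))"
  proof (rule contraction_step[OF _ m _ Suc.IH])
    show "h \<le> ?T" using d by simp
    have "0 \<le> 4 * h / (d - c)" using h_nonneg c_less_d by simp
    then have "0 < 1 + 4 * h / (d - c) + L" using L_nonneg by simp
    then show "0 < ?r ^ j * (1 + 4 * h / (d - c) + L)" using r by simp
    show "?T + (real m + 3) * d \<le> x" using Suc.prems by (simp add: algebra_simps)
  qed
  then show ?case by (simp add: mult_ac)
qed

end

section \<open>Reduction to the extremal agent\<close>

abbreviation orders :: "nat \<Rightarrow> (nat \<Rightarrow> nat) set" where
  "orders n \<equiv> {\<pi>. \<pi> permutes {..<n}}"

definition preds :: "nat \<Rightarrow> (nat \<Rightarrow> nat) \<Rightarrow> nat \<Rightarrow> nat set" where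
  "preds n \<pi> i = {j. j < n \<and> \<pi> j < \<pi> i}"

definition pivotal :: "nat \<Rightarrow> (nat \<Rightarrow> real) \<Rightarrow> real \<Rightarrow> nat \<Rightarrow> (nat \<Rightarrow> nat) \<Rightarrow> bool" where
  "pivotal n w Q i \<pi> \<longleftrightarrow> Q - w i \<le> (\<Sum>j\<in>preds n \<pi> i. w j) \<and> (\<Sum>j\<in>preds n \<pi> i. w j) < Q"

lemma finite_orders: "finite (orders n)" and card_orders: "card (orders n) = fact n"
  by (simp_all add: finite_permutations card_permutations)

lemma orders_nonempty: "orders n \<noteq> {}"
  using permutes_id by blast

lemma shapley_eq_sum: "shapley n w Q i = (\<Sum>\<pi>\<in>orders n. of_bool (pivotal n w Q i \<pi>)) / fact n"
proof -
  have "shapley n w Q i = card (orders n \<inter> {\<pi>. pivotal n w Q i \<pi>}) / fact n"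
    unfolding shapley_def pivotal_def preds_def
    by (subst measure_pmf_of_set) (use finite_orders card_orders orders_nonempty in auto)
  also have "real (card (orders n \<inter> {\<pi>. pivotal n w Q i \<pi>})) = (\<Sum>\<pi>\<in>orders n. of_bool (pivotal n w Q i \<pi>))"
    using finite_orders[of n] by (simp add: Int_def)
  finally show ?thesis .
qed

lemma shapley_cong:
  assumes "\<And>j. j < n \<Longrightarrow> w j = w' j" "i < n"
  shows "shapley n w Q i = shapley n w' Q i"
proof -
  have "(\<Sum>j\<in>preds n \<pi> i. w j) = (\<Sum>j\<in>preds n \<pi> i. w' j)" for \<pi>
    using assms by (intro sum.cong) (auto simp: preds_def)
  then show ?thesis using assms by (simp add: shapley_eq_sum pivotal_def)
qed

text \<open>Symmetry under relabelling: composition with \<open>inv \<sigma>\<close> permutes the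
  orders among themselves, and \<open>\<sigma>\<close> carries predecessors to predecessors.\<close>

lemma shapley_permute:
  assumes \<sigma>: "\<sigma> permutes {..<n}"
  shows "shapley n (w \<circ> \<sigma>) Q i = shapley n w Q (\<sigma> i)"
proof -
  have inv: "inv \<sigma> (\<sigma> j) = j" "\<sigma> (inv \<sigma> j) = j" for j
    using permutes_inverses[OF \<sigma>] by auto
  have "pivotal n (w \<circ> \<sigma>) Q i \<pi> \<longleftrightarrow> pivotal n w Q (\<sigma> i) (\<pi> \<circ> inv \<sigma>)" for \<pi>
  proof -
    have "preds n (\<pi> \<circ> inv \<sigma>) (\<sigma> i) = \<sigma> ` preds n \<pi> i"
    proof (intro set_eqI iffI)
      fix j assume j: "j \<in> preds n (\<pi> \<circ> inv \<sigma>) (\<sigma> i)"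
      then have "inv \<sigma> j \<in> preds n \<pi> i"
        using permutes_in_image[OF permutes_inv[OF \<sigma>], of j] by (simp add: preds_def inv)
      then show "j \<in> \<sigma> ` preds n \<pi> i" using inv(2)[of j] by (metis imageI)
    next
      fix j assume "j \<in> \<sigma> ` preds n \<pi> i"
      then obtain l where l: "j = \<sigma> l" "l < n" "\<pi> l < \<pi> i" by (auto simp: preds_def)
      moreover have "\<sigma> l < n" using permutes_in_image[OF \<sigma>, of l] l(2) by simp
      ultimately show "j \<in> preds n (\<pi> \<circ> inv \<sigma>) (\<sigma> i)"
        by (simp add: preds_def inv)
    qed
    then have "(\<Sum>j\<in>preds n (\<pi> \<circ> inv \<sigma>) (\<sigma> i). w j) = (\<Sum>j\<in>preds n \<pi> i. (w \<circ> \<sigma>) j)"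
      using permutes_inj_on[OF \<sigma>] by (simp add: sum.reindex)
    then show ?thesis by (simp add: pivotal_def)
  qed
  then have "shapley n (w \<circ> \<sigma>) Q i = (\<Sum>\<pi>\<in>orders n. of_bool (pivotal n w Q (\<sigma> i) (\<pi> \<circ> inv \<sigma>))) / fact n"
    by (simp add: shapley_eq_sum)
  also have "(\<Sum>\<pi>\<in>orders n. of_bool (pivotal n w Q (\<sigma> i) (\<pi> \<circ> inv \<sigma>)))
      = (\<Sum>\<pi>\<in>orders n. of_bool (pivotal n w Q (\<sigma> i) \<pi>) :: real)"
    using sum_permutations_compose_right[OF permutes_inv[OF \<sigma>], of "\<lambda>\<pi>. of_bool (pivotal n w Q (\<sigma> i) \<pi>) :: real"]
    by simp
  finally show ?thesis by (simp only: shapley_eq_sum)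
qed

lemma sorted_weights_permutation:
  obtains \<sigma> where "\<sigma> permutes {..<n}" "\<And>k. k < n \<Longrightarrow> sorted_weights n x k = x (\<sigma> k)"
proof -
  have "mset (sort (map x [0..<n])) = mset (map x [0..<n])" by simp
  then obtain \<sigma> where \<sigma>: "\<sigma> permutes {..<length (map x [0..<n])}"
      and eq: "permute_list \<sigma> (map x [0..<n]) = sort (map x [0..<n])"
    by (rule mset_eq_permutation)
  have \<sigma>': "\<sigma> permutes {..<n}" using \<sigma> by simp
  have "sorted_weights n x k = x (\<sigma> k)" if "k < n" for k
  proof -
    have "\<sigma> k < n" using permutes_in_image[OF \<sigma>', of k] that by simp
    then show ?thesis
      using permute_list_nth[OF \<sigma>, of k] that by (simp add: sorted_weights_def flip: eq)
  qed
  with \<sigma>' show thesis by (rule that)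
qed

lemma sorted_weights_mono: "k \<le> l \<Longrightarrow> l < n \<Longrightarrow> sorted_weights n x k \<le> sorted_weights n x l"
  unfolding sorted_weights_def by (intro sorted_nth_mono) auto

text \<open>Ties are harmless: agents of equal weight have equal Shapley values.\<close>

lemma shapley_sorted_weights:
  assumes "i < n" "k < n" "x i = sorted_weights n x k"
  shows "shapley n (sorted_weights n x) Q k = shapley n x Q i"
proof -
  obtain \<sigma> where \<sigma>: "\<sigma> permutes {..<n}" "\<And>k. k < n \<Longrightarrow> sorted_weights n x k = x (\<sigma> k)"
    using sorted_weights_permutation by blast
  have "shapley n (sorted_weights n x) Q k = shapley n (x \<circ> \<sigma>) Q k"
    using \<sigma> assms by (intro shapley_cong) auto
  also have "\<dots> = shapley n x Q (\<sigma> k)" by (rule shapley_permute) fact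
  also have "\<dots> = shapley n (x \<circ> Transposition.transpose i (\<sigma> k)) Q i"
    using assms permutes_in_image[OF \<sigma>(1), of k]
    by (subst shapley_permute) (auto intro: permutes_swap_id)
  also have "x \<circ> Transposition.transpose i (\<sigma> k) = x"
    using assms \<sigma>(2)[of k] by (auto simp: fun_eq_iff Transposition.transpose_def)
  finally show ?thesis .
qed

text \<open>The sign \<open>\<sigma>\<close> selects the largest (\<open>\<sigma> = 1\<close>) or the smallest (\<open>\<sigma> = -1\<close>) weight; ties are broken by
the index, so that exactly one agent is extremal.\<close>

definition beats :: "real \<Rightarrow> nat \<Rightarrow> nat \<Rightarrow> real \<Rightarrow> real \<Rightarrow> bool" where
  "beats \<sigma> i j t s \<longleftrightarrow> (if j < i then \<sigma> * s < \<sigma> * t else \<sigma> * s \<le> \<sigma> * t)"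

definition extremal :: "nat \<Rightarrow> real \<Rightarrow> (nat \<Rightarrow> real) \<Rightarrow> nat \<Rightarrow> bool" where
  "extremal n \<sigma> x i \<longleftrightarrow> (\<forall>j\<in>{..<n} - {i}. beats \<sigma> i j (x i) (x j))"

lemma ex1_extremal:
  assumes "0 < n"
  shows "\<exists>!i. i < n \<and> extremal n \<sigma> x i"
proof -
  let ?f = "\<lambda>j. \<sigma> * x j"
  define m where "m = Max (?f ` {..<n})"
  have "m \<in> ?f ` {..<n}" unfolding m_def using assms by (intro Max_in) auto
  then obtain i0 where i0: "i0 < n \<and> ?f i0 = m" by auto
  \<comment> \<open>The least maximizer, since \<open>beats\<close> asks for strict inequality
    against smaller indices.\<close>
  define i where "i = (LEAST i. i < n \<and> ?f i = m)"
  have i: "i < n" "?f i = m" using LeastI[of "\<lambda>i. i < n \<and> ?f i = m", OF i0] by (auto simp: i_def)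
  have le: "?f j \<le> m" if "j < n" for j unfolding m_def using that by (intro Max_ge) auto
  have lt: "?f j < m" if "j < i" for j
  proof -
    have "j < n" using that i by simp
    moreover have "\<not> (j < n \<and> ?f j = m)"
      using not_less_Least[of j "\<lambda>i. i < n \<and> ?f i = m"] that unfolding i_def by blast
    ultimately show ?thesis using le[of j] by linarith
  qed
  show ?thesis
  proof (rule ex1I[of _ i])
    show "i < n \<and> extremal n \<sigma> x i" using i le lt by (auto simp: extremal_def beats_def)
  next
    fix k assume k: "k < n \<and> extremal n \<sigma> x k"
    show "k = i"
    proof (rule ccontr)
      assume "k \<noteq> i"
      then have "beats \<sigma> k i (x k) (x i)" using k i by (auto simp: extremal_def)
      moreover have "?f k < m \<or> i < k" using \<open>k \<noteq> i\<close> lt[of k] by auto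
      ultimately show False using i le[of k] k by (auto simp: beats_def split: if_splits)
    qed
  qed
qed

lemma extremal_le:
  assumes "extremal n \<sigma> x i" "j < n"
  shows "\<sigma> * x j \<le> \<sigma> * x i"
proof (cases "j = i")
  case False
  then have "beats \<sigma> i j (x i) (x j)" using assms by (simp add: extremal_def)
  then show ?thesis unfolding beats_def by (rule contrapos_pp) simp
qed simp

text \<open>Which agent is extremal is random, but the sum runs over fixed agents, so the
  expectation can be taken agent by agent with one coordinate singled out. Uniqueness of the
  extremal agent leaves a single term.\<close>

lemma shapley_sorted_extremal:
  assumes "0 < n" and "\<sigma> = 1 \<and> k = n - 1 \<or> \<sigma> = -1 \<and> k = 0"
  shows "shapley n (sorted_weights n x) Q k = (\<Sum>i<n. of_bool (extremal n \<sigma> x i) * shapley n x Q i)"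
proof -
  obtain i where i: "i < n" "extremal n \<sigma> x i" and uniq: "\<And>j. j < n \<Longrightarrow> extremal n \<sigma> x j \<Longrightarrow> j = i"
    using ex1_extremal[OF assms(1), of \<sigma> x] by blast
  obtain p where p: "p permutes {..<n}" "\<And>k. k < n \<Longrightarrow> sorted_weights n x k = x (p k)"
    using sorted_weights_permutation by blast
  have "k < n" using assms by auto
  then have pk: "p k < n" using permutes_in_image[OF p(1), of k] by simp
  have "i \<in> p ` {..<n}" using permutes_image[OF p(1)] i by simp
  then obtain l where l: "l < n" "p l = i" by auto
  have eq: "sorted_weights n x k = x (p k)" "sorted_weights n x l = x i"
    using p(2)[of k] p(2)[of l] l \<open>k < n\<close> by simp_all
  have ext: "\<sigma> * x (p k) \<le> \<sigma> * x i" by (rule extremal_le[OF i(2) pk])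
  from assms(2) have "x i = sorted_weights n x k"
  proof (elim disjE conjE)
    assume "\<sigma> = 1" "k = n - 1"
    then have "x i \<le> x (p k)" using sorted_weights_mono[of l k n x] l \<open>k < n\<close> eq by simp
    then show ?thesis using ext \<open>\<sigma> = 1\<close> eq by simp
  next
    assume "\<sigma> = -1" "k = 0"
    then have "x (p k) \<le> x i" using sorted_weights_mono[of k l n x] l eq by simp
    then show ?thesis using ext \<open>\<sigma> = -1\<close> eq by simp
  qed
  then have "shapley n (sorted_weights n x) Q k = shapley n x Q i"
    using i \<open>k < n\<close> by (intro shapley_sorted_weights)
  also have "\<dots> = (\<Sum>j<n. if j = i then shapley n x Q i else 0)"
    using i by simp
  also have "\<dots> = (\<Sum>j<n. of_bool (extremal n \<sigma> x j) * shapley n x Q j)"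
  proof (intro sum.cong refl)
    fix j assume "j \<in> {..<n}"
    then show "(if j = i then shapley n x Q i else 0) = of_bool (extremal n \<sigma> x j) * shapley n x Q j"
      using uniq[of j] i(2) by (cases "j = i") auto
  qed
  finally show ?thesis .
qed

text \<open>The coordinates are integrated out one at a time. Each contributes the factor
  \<open>(d - c) / (b - a)\<close> for meeting its restriction \<open>R j\<close>; given that, it is
  uniform on \<open>[c, d]\<close>, and if it lies in \<open>P\<close> it adds one step to
  \<open>window_prob\<close>. The counter \<open>m\<close> records the steps already
  integrated.\<close>

lemma integral_PiM_window:
  assumes "a \<le> c" "c < d" "d \<le> b" "0 \<le> c" "0 \<le> h" "finite J"
    and R: "\<And>j. j \<in> J \<Longrightarrow> {s. R j s} \<in> sets borel \<and> {c<..<d} \<subseteq> {s. R j s} \<and> {s. R j s} \<inter> {a..b} \<subseteq> {c..d}"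
  shows "(\<integral>x. of_bool (\<forall>j\<in>J. R j (x j)) * window_prob c d h m (Q - (\<Sum>j\<in>P \<inter> J. x j))
            \<partial>PiM J (\<lambda>_. unif a b))
         = ((d - c) / (b - a)) ^ card J * window_prob c d h (m + card (P \<inter> J)) Q"
  using \<open>finite J\<close> R
proof (induction J arbitrary: m rule: finite_induct)
  case empty
  show ?case by (simp add: PiM_empty lebesgue_integral_count_space_finite)
next
  case (insert j J)
  interpret R: uniform_renewal c d h using assms by unfold_locales
  have "a < b" using assms by simp
  interpret U: prob_space "unif a b" by (rule prob_space_unif) fact
  interpret PS: product_prob_space "\<lambda>_. unif a b" by unfold_locales
  let ?p = "(d - c) / (b - a)"
  let ?F = "\<lambda>x. of_bool (\<forall>j\<in>insert j J. R j (x j)) * window_prob c d h m (Q - (\<Sum>j\<in>P \<inter> insert j J. x j))"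
  have [measurable]: "Measurable.pred borel (R j')" if "j' \<in> insert j J" for j'
    using insert.prems[OF that] by (simp add: pred_def)
  have [measurable]: "Measurable.pred borel (R j)"
    using insert.prems[of j] by (simp add: pred_def)
  have fin: "finite (insert j J)" using insert by simp
  have meas: "?F \<in> borel_measurable (PiM (insert j J) (\<lambda>_. unif a b))"
    using fin by measurable
  have int: "integrable (PiM (insert j J) (\<lambda>_. unif a b)) ?F"
  proof -
    interpret F: prob_space "PiM (insert j J) (\<lambda>_. unif a b)"
      by (rule prob_space_PiM) (rule U.prob_space_axioms)
    show ?thesis
      using R.u_bounds by (intro F.integrable_const_bound[where B = 1] meas) auto
  qed
  have "(\<integral>x. ?F x \<partial>PiM (insert j J) (\<lambda>_. unif a b))
      = (\<integral>x. (\<integral>y. ?F (x(j := y)) \<partial>unif a b) \<partial>PiM J (\<lambda>_. unif a b))"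
    using insert(1,2) int by (rule PS.product_integral_insert)
  also have "\<dots> = (\<integral>x. ?p * (of_bool (\<forall>j\<in>J. R j (x j)) *
      window_prob c d h (m + card (P \<inter> {j})) (Q - (\<Sum>j\<in>P \<inter> J. x j))) \<partial>PiM J (\<lambda>_. unif a b))"
  proof (rule Bochner_Integration.integral_cong[OF refl])
    fix x
    let ?A = "of_bool (\<forall>j\<in>J. R j (x j)) :: real" and ?S = "\<Sum>j\<in>P \<inter> J. x j"
    have all: "(\<forall>j'\<in>insert j J. R j' ((x(j := y)) j')) \<longleftrightarrow> R j y \<and> (\<forall>j\<in>J. R j (x j))" for y
      using insert(2) by auto
    have unch: "(\<Sum>j'\<in>P \<inter> J. (x(j := y)) j') = ?S" for y
      using insert(2) by (intro sum.cong) auto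
    have key: "(\<integral>y. indicator {s. R j s} y * f y \<partial>unif a b) = ?p * (\<integral>y. f y \<partial>unif c d)"
      if "f \<in> borel_measurable borel" for f :: "real \<Rightarrow> real"
      using assms insert.prems[of j] that by (intro integral_unif_indicator) auto
    show "(\<integral>y. ?F (x(j := y)) \<partial>unif a b)
        = ?p * (?A * window_prob c d h (m + card (P \<inter> {j})) (Q - ?S))"
    proof (cases "j \<in> P")
      case True
      have "(\<Sum>j'\<in>P \<inter> insert j J. (x(j := y)) j') = y + ?S" for y
        using insert(1,2) True unch[of y] by (simp add: Int_insert_right)
      then have "(\<integral>y. ?F (x(j := y)) \<partial>unif a b)
          = (\<integral>y. indicator {s. R j s} y * (?A * window_prob c d h m (Q - ?S - y)) \<partial>unif a b)"
        unfolding all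
        by (intro Bochner_Integration.integral_cong) (auto simp: indicator_def algebra_simps)
      also have "\<dots> = ?p * (\<integral>y. ?A * window_prob c d h m (Q - ?S - y) \<partial>unif c d)"
        by (rule key) measurable
      finally show ?thesis using True by simp
    next
      case False
      have "(\<Sum>j'\<in>P \<inter> insert j J. (x(j := y)) j') = ?S" for y
        using False unch[of y] by simp
      then have "(\<integral>y. ?F (x(j := y)) \<partial>unif a b)
          = (\<integral>y. indicator {s. R j s} y * (?A * window_prob c d h m (Q - ?S)) \<partial>unif a b)"
        unfolding all
        by (intro Bochner_Integration.integral_cong) (auto simp: indicator_def)
      also have "\<dots> = ?p * (\<integral>y. ?A * window_prob c d h m (Q - ?S) \<partial>unif c d)"
        by (rule key) measurable
      finally show ?thesis using False by (simp add: R.X.prob_space[simplified])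
    qed
  qed
  also have "\<dots> = ?p * (?p ^ card J * window_prob c d h (m + card (P \<inter> {j}) + card (P \<inter> J)) Q)"
    using insert.IH[of "m + card (P \<inter> {j})"] insert.prems by simp
  also have "m + card (P \<inter> {j}) + card (P \<inter> J) = m + card (P \<inter> insert j J)"
    using insert(1,2) by (cases "j \<in> P") (auto simp: Int_insert_right)
  finally show ?case using insert(1,2) by simp
qed


text \<open>The extremal agent, given its weight \<open>t\<close>: all other weights are independent and uniform on
\<open>[lo t, hi t]\<close>.\<close>

locale extremal_weight =
  fixes a b \<sigma> :: real and lo hi :: "real \<Rightarrow> real"
  assumes a_nonneg: "0 \<le> a" and a_less_b: "a < b"
    and range: "\<And>t. a < t \<Longrightarrow> t < b \<Longrightarrow> a \<le> lo t \<and> lo t < hi t \<and> hi t \<le> b"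
    and beaten: "\<And>t i j. a < t \<Longrightarrow> t < b \<Longrightarrow> {lo t<..<hi t} \<subseteq> {s. beats \<sigma> i j t s}
                    \<and> {s. beats \<sigma> i j t s} \<inter> {a..b} \<subseteq> {lo t..hi t}"
begin

sublocale U: prob_space "unif a b"
  by (rule prob_space_unif[OF a_less_b])

sublocale PS: product_prob_space "\<lambda>_. unif a b" UNIV
  by unfold_locales

text \<open>The probability that an independent weight is beaten by one of value
  \<open>t\<close>.\<close>

definition "p t = (hi t - lo t) / (b - a)"

lemma prob_space_samples: "prob_space (PiM J (\<lambda>_. unif a b))"
  by (rule prob_space_PiM) (rule U.prob_space_axioms)

lemma component_measurable:
  assumes "j < n"
  shows "(\<lambda>x. x j) \<in> borel_measurable (samples n a b)"
proof -
  have "measurable (samples n a b) (unif a b) = borel_measurable (samples n a b)"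
    by (rule measurable_cong_sets) auto
  then show ?thesis
    using measurable_component_singleton[of j "{..<n}" "\<lambda>_. unif a b"] assms by (simp add: samples_def)
qed

lemma pivotal_measurable [measurable]:
  assumes "i < n"
  shows "Measurable.pred (samples n a b) (\<lambda>x. pivotal n x Q i \<pi>)"
proof -
  have sum: "(\<lambda>x. \<Sum>j\<in>preds n \<pi> i. x j) \<in> borel_measurable (samples n a b)"
    by (intro borel_measurable_sum component_measurable) (simp add: preds_def)
  show ?thesis unfolding pivotal_def pred_def
    by (intro sets.sets_Collect_conj borel_measurable_le borel_measurable_less borel_measurable_diff
        borel_measurable_const component_measurable sum assms)
qed

lemma extremal_measurable [measurable]:
  assumes "i < n"
  shows "Measurable.pred (samples n a b) (\<lambda>x. extremal n \<sigma> x i)"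
proof -
  have "Measurable.pred (samples n a b) (\<lambda>x. beats \<sigma> i j (x i) (x j))" if "j < n" for j
  proof -
    show ?thesis
      unfolding beats_def pred_def using assms that
      by (cases "j < i") (auto intro!: borel_measurable_le borel_measurable_less borel_measurable_times
          borel_measurable_const component_measurable)
  qed
  then show ?thesis unfolding extremal_def by (intro pred_intros_finite) auto
qed

text \<open>Positions count from 0, so \<open>\<pi> i\<close> is exactly the index of the partial
  sum that precedes agent \<open>i\<close>.\<close>

lemma card_preds:
  assumes "\<pi> \<in> orders n" "i < n"
  shows "card (preds n \<pi> i) = \<pi> i"
proof -
  have \<pi>: "\<pi> permutes {..<n}" using assms by simp
  have "\<pi> i < n" using permutes_in_image[OF \<pi>, of i] assms by simp
  have "\<pi> ` preds n \<pi> i = {..<\<pi> i}"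
  proof (intro set_eqI iffI)
    fix k assume "k \<in> {..<\<pi> i}"
    then have "k \<in> \<pi> ` {..<n}" using \<open>\<pi> i < n\<close> permutes_image[OF \<pi>] by simp
    then show "k \<in> \<pi> ` preds n \<pi> i" using \<open>k \<in> {..<\<pi> i}\<close> by (auto simp: preds_def)
  qed (auto simp: preds_def)
  then show ?thesis
    using card_image[OF permutes_inj_on[OF \<pi>], of "preds n \<pi> i"] by simp
qed

text \<open>The function of \<open>t\<close> arises by integrating out the other coordinates, which
  makes it measurable and bounded on the whole line; the closed formula is claimed only for
  \<open>a < t < b\<close>, where the locale describes the other weights. This avoids a separate
  proof that \<open>window_prob\<close> is measurable when its parameters move with
  \<open>t\<close>.\<close>

lemma expectation_extremal_pivotal:
  assumes "i < n" "\<pi> \<in> orders n"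
  shows "\<exists>g. g \<in> borel_measurable borel \<and> (\<forall>t. \<bar>g t\<bar> \<le> 1) \<and>
    (\<integral>x. of_bool (extremal n \<sigma> x i) * of_bool (pivotal n x Q i \<pi>) \<partial>samples n a b) = (\<integral>t. g t \<partial>unif a b) \<and>
    (\<forall>t. a < t \<longrightarrow> t < b \<longrightarrow> g t = p t ^ (n - 1) * window_prob (lo t) (hi t) t (\<pi> i) Q)"
proof -
  define J where "J = {..<n} - {i}"
  let ?P = "preds n \<pi> i"
  let ?M = "PiM J (\<lambda>_. unif a b)"
  have J: "finite J" "i \<notin> J" "insert i J = {..<n}" "?P \<subseteq> J" "i \<notin> ?P" "card J = n - 1"
    using assms(1) by (auto simp: J_def preds_def)
  define F where "F x = (of_bool (extremal n \<sigma> x i) * of_bool (pivotal n x Q i \<pi>) :: real)" for x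
  define F' where "F' t x = (of_bool (\<forall>j\<in>J. beats \<sigma> i j t (x j)) *
    of_bool (Q - t \<le> (\<Sum>j\<in>?P. x j) \<and> (\<Sum>j\<in>?P. x j) < Q) :: real)" for t x
  have F': "F (x(i := t)) = F' t x" for x t
  proof -
    have "(\<Sum>j\<in>?P. (x(i := t)) j) = (\<Sum>j\<in>?P. x j)" using J by (intro sum.cong) auto
    moreover have "extremal n \<sigma> (x(i := t)) i \<longleftrightarrow> (\<forall>j\<in>J. beats \<sigma> i j t (x j))"
      by (auto simp: extremal_def J_def)
    ultimately show ?thesis by (simp add: F_def F'_def pivotal_def)
  qed
  interpret M: prob_space ?M by (rule prob_space_samples)
  have inP: "j \<in> J" if "j \<in> ?P" for j using that J by auto
  have F'_meas [measurable]: "(\<lambda>(t, x). F' t x) \<in> borel_measurable (borel \<Otimes>\<^sub>M ?M)"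
  proof -
    have comp [measurable]: "(\<lambda>z. snd z j) \<in> borel_measurable (borel \<Otimes>\<^sub>M ?M)" if "j \<in> J" for j
      using that by measurable
    have "Measurable.pred (borel \<Otimes>\<^sub>M ?M) (\<lambda>z. beats \<sigma> i j (fst z) (snd z j))" if "j \<in> J" for j
      using that by (cases "j < i") (simp_all add: beats_def)
    then have [measurable]: "Measurable.pred (borel \<Otimes>\<^sub>M ?M) (\<lambda>z. \<forall>j\<in>J. beats \<sigma> i j (fst z) (snd z j))"
      using J(1) by (intro pred_intros_finite)
    have [measurable]: "(\<lambda>z. \<Sum>j\<in>?P. snd z j) \<in> borel_measurable (borel \<Otimes>\<^sub>M ?M)"
      using inP by (intro borel_measurable_sum comp)
    show ?thesis unfolding F'_def split_beta by measurable
  qed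
  define g where "g t = (\<integral>x. F' t x \<partial>?M)" for t
  have g_meas [measurable]: "g \<in> borel_measurable borel"
    unfolding g_def[abs_def] by measurable
  have F'_int: "integrable ?M (F' t)" for t
  proof (rule M.integrable_const_bound[where B = 1])
    show "F' t \<in> borel_measurable ?M"
      using F'_meas by measurable
  qed (simp add: F'_def)
  have g_bounds: "0 \<le> g t \<and> g t \<le> 1" for t
  proof -
    have "g t \<le> (\<integral>x. 1 \<partial>?M)"
      unfolding g_def by (rule integral_mono[OF F'_int]) (auto simp: F'_def)
    then show ?thesis by (simp add: g_def M.prob_space F'_def)
  qed
  have F_nonneg: "0 \<le> F x" for x by (simp add: F_def)
  have F_meas [measurable]: "F \<in> borel_measurable (samples n a b)"
    unfolding F_def[abs_def] using assms(1) by measurable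
  \<comment> \<open>Tonelli with the coordinate \<open>i\<close> outermost, so that \<open>t\<close>
    is fixed while the others are integrated; \<open>F\<close> is nonnegative, hence the passage
    through \<open>ennreal\<close>.\<close>
  have "(\<integral>\<^sup>+x. ennreal (F x) \<partial>samples n a b) = (\<integral>\<^sup>+t. (\<integral>\<^sup>+x. ennreal (F (x(i := t))) \<partial>?M) \<partial>unif a b)"
    unfolding samples_def J(3)[symmetric]
  proof (rule PS.product_nn_integral_insert_rev[OF J(1,2)])
    show "(\<lambda>x. ennreal (F x)) \<in> borel_measurable (PiM (insert i J) (\<lambda>_. unif a b))"
      using F_meas unfolding samples_def J(3) by simp
  qed
  also have "\<dots> = (\<integral>\<^sup>+t. ennreal (g t) \<partial>unif a b)"
    unfolding F' g_def by (intro nn_integral_cong nn_integral_eq_integral F'_int) (auto simp: F'_def)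
  finally have "(\<integral>x. F x \<partial>samples n a b) = (\<integral>t. g t \<partial>unif a b)"
    using g_bounds F_nonneg
      by (simp add: integral_eq_nn_integral[OF F_meas] integral_eq_nn_integral[of g])
  moreover have "g t = p t ^ (n - 1) * window_prob (lo t) (hi t) t (\<pi> i) Q" if t: "a < t" "t < b" for t
  proof -
    have "g t = (\<integral>x. of_bool (\<forall>j\<in>J. beats \<sigma> i j t (x j)) *
        window_prob (lo t) (hi t) t 0 (Q - (\<Sum>j\<in>?P \<inter> J. x j)) \<partial>?M)"
      unfolding g_def F'_def using J(4)
      by (intro Bochner_Integration.integral_cong) (auto simp: Int_absorb2)
    also have "\<dots> = ((hi t - lo t) / (b - a)) ^ card J * window_prob (lo t) (hi t) t (0 + card (?P \<inter> J)) Q"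
    proof (rule integral_PiM_window[OF _ _ _ _ _ J(1)])
      fix j
      have "{s. beats \<sigma> i j t s} \<in> sets borel" by (simp add: beats_def pred_def[symmetric])
      then show "{s. beats \<sigma> i j t s} \<in> sets borel \<and> {lo t<..<hi t} \<subseteq> {s. beats \<sigma> i j t s}
          \<and> {s. beats \<sigma> i j t s} \<inter> {a..b} \<subseteq> {lo t..hi t}"
        using beaten[OF t] by blast
    qed (use range[OF t] t a_nonneg in auto)
    also have "card (?P \<inter> J) = \<pi> i"
      using card_preds[OF assms(2,1)] J(4) by (simp add: Int_absorb2)
    finally show ?thesis by (simp add: p_def J(6))
  qed
  ultimately show ?thesis
    using g_bounds g_meas unfolding F_def by (intro exI[of _ g]) (auto simp: abs_le_iff intro: order_trans[of _ 0])
qed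

text \<open>Under a fixed order, the positions of the \<open>n\<close> candidates for the extremal
  agent run once through \<open>0, ..., n - 1\<close>. Summing over the candidates thus yields each
  partial sum once, whatever the order, and the average over orders changes nothing.\<close>

lemma exp_shapley_extremal:
  assumes "0 < n" and "\<sigma> = 1 \<and> k = n - 1 \<or> \<sigma> = -1 \<and> k = 0"
  shows "\<exists>g. g \<in> borel_measurable borel \<and> integrable (unif a b) g \<and>
    exp_shapley n a b k Q = (\<integral>t. g t \<partial>unif a b) \<and>
    (\<forall>t. a < t \<longrightarrow> t < b \<longrightarrow> g t = p t ^ (n - 1) * (\<Sum>m<n. window_prob (lo t) (hi t) t m Q))"
proof -
  let ?F = "\<lambda>i \<pi> x. of_bool (extremal n \<sigma> x i) * of_bool (pivotal n x Q i \<pi>) :: real"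
  define good where "good i \<pi> g \<longleftrightarrow> g \<in> borel_measurable borel \<and> (\<forall>t. \<bar>g t\<bar> \<le> 1) \<and>
    (\<integral>x. ?F i \<pi> x \<partial>samples n a b) = (\<integral>t. g t \<partial>unif a b) \<and>
    (\<forall>t. a < t \<longrightarrow> t < b \<longrightarrow> g t = p t ^ (n - 1) * window_prob (lo t) (hi t) t (\<pi> i) Q)" for i \<pi> g
  have "\<forall>z\<in>{..<n} \<times> orders n. \<exists>g. good (fst z) (snd z) g"
    using expectation_extremal_pivotal unfolding good_def by auto
  from bchoice[OF this] obtain g' where g': "\<forall>z\<in>{..<n} \<times> orders n. good (fst z) (snd z) (g' z)" ..
  define g where "g i \<pi> = g' (i, \<pi>)" for i \<pi>
  have good: "good i \<pi> (g i \<pi>)" if "i \<in> {..<n}" "\<pi> \<in> orders n" for i \<pi>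
    using bspec[OF g', of "(i, \<pi>)"] that by (simp add: g_def)
  have g_meas [measurable]: "g i \<pi> \<in> borel_measurable borel"
    and g_bd: "\<bar>g i \<pi> t\<bar> \<le> 1"
    and g_int: "(\<integral>x. ?F i \<pi> x \<partial>samples n a b) = (\<integral>t. g i \<pi> t \<partial>unif a b)"
    and g_eq: "a < t \<Longrightarrow> t < b \<Longrightarrow> g i \<pi> t = p t ^ (n - 1) * window_prob (lo t) (hi t) t (\<pi> i) Q"
    if "i \<in> {..<n}" "\<pi> \<in> orders n" for i \<pi> t
    using good[OF that] unfolding good_def by blast+
  interpret S: prob_space "samples n a b" unfolding samples_def by (rule prob_space_samples)
  have F_int: "integrable (samples n a b) (?F i \<pi>)" if "i \<in> {..<n}" for i \<pi>
    using that by (intro S.integrable_const_bound[where B = 1]) auto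
  have gi: "integrable (unif a b) (g i \<pi>)" if "i \<in> {..<n}" "\<pi> \<in> orders n" for i \<pi>
    using that g_bd by (intro integrable_unif[where B = 1] a_less_b g_meas) auto
  define G where "G t = (\<Sum>i<n. \<Sum>\<pi>\<in>orders n. g i \<pi> t) / fact n" for t
  have "exp_shapley n a b k Q = (\<integral>x. (\<Sum>i<n. \<Sum>\<pi>\<in>orders n. ?F i \<pi> x) / fact n \<partial>samples n a b)"
    unfolding exp_shapley_def shapley_sorted_extremal[OF assms]
    by (simp add: shapley_eq_sum sum_distrib_left sum_divide_distrib)
  also have "\<dots> = (\<Sum>i<n. \<Sum>\<pi>\<in>orders n. (\<integral>x. ?F i \<pi> x \<partial>samples n a b)) / fact n"
    using F_int by (simp add: Bochner_Integration.integral_sum)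
  also have "\<dots> = (\<Sum>i<n. \<Sum>\<pi>\<in>orders n. (\<integral>t. g i \<pi> t \<partial>unif a b)) / fact n"
    using g_int by simp
  also have "\<dots> = (\<integral>t. G t \<partial>unif a b)"
  proof -
    have "(\<integral>t. (\<Sum>i<n. \<Sum>\<pi>\<in>orders n. g i \<pi> t) \<partial>unif a b)
        = (\<Sum>i<n. (\<integral>t. (\<Sum>\<pi>\<in>orders n. g i \<pi> t) \<partial>unif a b))"
      by (rule Bochner_Integration.integral_sum) (intro Bochner_Integration.integrable_sum gi)
    also have "\<dots> = (\<Sum>i<n. \<Sum>\<pi>\<in>orders n. (\<integral>t. g i \<pi> t \<partial>unif a b))"
      by (intro sum.cong refl Bochner_Integration.integral_sum gi)
    finally show ?thesis by (simp add: G_def)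
  qed
  finally have "exp_shapley n a b k Q = (\<integral>t. G t \<partial>unif a b)" .
  moreover have "G \<in> borel_measurable borel"
    unfolding G_def[abs_def] using g_meas by (intro borel_measurable_divide borel_measurable_sum) auto
  moreover have "integrable (unif a b) G"
    unfolding G_def[abs_def] using gi by (intro integrable_divide Bochner_Integration.integrable_sum) auto
  moreover have "G t = p t ^ (n - 1) * (\<Sum>m<n. window_prob (lo t) (hi t) t m Q)" if "a < t" "t < b" for t
  proof -
    let ?w = "\<lambda>m. window_prob (lo t) (hi t) t m Q"
    have "(\<Sum>i<n. \<Sum>\<pi>\<in>orders n. g i \<pi> t) = (\<Sum>i<n. \<Sum>\<pi>\<in>orders n. p t ^ (n - 1) * ?w (\<pi> i))"
      using that g_eq by (intro sum.cong refl) auto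
    also have "\<dots> = (\<Sum>\<pi>\<in>orders n. p t ^ (n - 1) * (\<Sum>i<n. ?w (\<pi> i)))"
      by (subst sum.swap) (simp add: sum_distrib_left)
    also have "\<dots> = (\<Sum>\<pi>\<in>orders n. p t ^ (n - 1) * (\<Sum>m<n. ?w m))"
    proof (intro sum.cong refl)
      fix \<pi> assume "\<pi> \<in> orders n"
      then have "(\<Sum>i<n. ?w (\<pi> i)) = (\<Sum>m<n. ?w m)"
        using sum.permute[of \<pi> "{..<n}" ?w] by (simp add: o_def)
      then show "p t ^ (n - 1) * (\<Sum>i<n. ?w (\<pi> i)) = p t ^ (n - 1) * (\<Sum>m<n. ?w m)" by simp
    qed
    also have "\<dots> = fact n * (p t ^ (n - 1) * (\<Sum>m<n. ?w m))"
      by (simp add: card_orders)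
    finally show ?thesis by (simp add: G_def)
  qed
  ultimately show ?thesis by blast
qed

text \<open>The factor \<open>p t ^ (n - 1)\<close> stays inside the error bound, so a poor
  approximation is tolerable where \<open>p t\<close> is small.\<close>

lemma exp_shapley_approx:
  assumes "0 < n" and "\<sigma> = 1 \<and> k = n - 1 \<or> \<sigma> = -1 \<and> k = 0"
    and [measurable]: "p \<in> borel_measurable borel" "l \<in> borel_measurable borel"
    and l: "\<And>t. t \<in> {a..b} \<Longrightarrow> \<bar>p t ^ (n - 1) * l t\<bar> \<le> B"
    and e: "\<And>t. a < t \<Longrightarrow> t < b \<Longrightarrow>
      \<bar>p t ^ (n - 1) * ((\<Sum>m<n. window_prob (lo t) (hi t) t m Q) - l t)\<bar> \<le> e"
  shows "\<bar>exp_shapley n a b k Q - 1 / (b - a) * integral {a..b} (\<lambda>t. p t ^ (n - 1) * l t)\<bar> \<le> e"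
proof -
  obtain g where [measurable]: "g \<in> borel_measurable borel" and g: "integrable (unif a b) g"
      "exp_shapley n a b k Q = (\<integral>t. g t \<partial>unif a b)"
      "\<And>t. a < t \<Longrightarrow> t < b \<Longrightarrow> g t = p t ^ (n - 1) * (\<Sum>m<n. window_prob (lo t) (hi t) t m Q)"
    using exp_shapley_extremal[OF assms(1,2)] by blast
  have int: "integrable (unif a b) (\<lambda>t. p t ^ (n - 1) * l t)"
    using l by (intro integrable_unif a_less_b) auto
  have "(\<integral>t. p t ^ (n - 1) * l t \<partial>unif a b) = integral {a..b} (\<lambda>t. p t ^ (n - 1) * l t) / (b - a)"
    using l by (intro integral_unif a_less_b) auto
  then have "exp_shapley n a b k Q - 1 / (b - a) * integral {a..b} (\<lambda>t. p t ^ (n - 1) * l t)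
      = (\<integral>t. g t - p t ^ (n - 1) * l t \<partial>unif a b)"
    using g int by simp
  moreover have "\<bar>\<integral>t. g t - p t ^ (n - 1) * l t \<partial>unif a b\<bar> \<le> (\<integral>t. e \<partial>unif a b)"
  proof (rule order_trans[OF integral_abs_bound])
    have ae: "AE t in unif a b. a < t \<and> t < b"
    proof -
      have "AE t in lborel. t \<noteq> a \<and> t \<noteq> b"
        using AE_lborel_singleton[of a] AE_lborel_singleton[of b] by eventually_elim auto
      then have "AE t in lborel. t \<in> {a..b} \<longrightarrow> a < t \<and> t < b"
        by eventually_elim auto
      then show ?thesis unfolding unif_def by (intro AE_uniform_measureI) auto
    qed
    show "(\<integral>t. \<bar>g t - p t ^ (n - 1) * l t\<bar> \<partial>unif a b) \<le> (\<integral>t. e \<partial>unif a b)"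
    proof (rule integral_mono_AE)
      show "AE t in unif a b. \<bar>g t - p t ^ (n - 1) * l t\<bar> \<le> e"
        using ae by eventually_elim (use g(3) e in \<open>simp add: right_diff_distrib\<close>)
    qed (use g(1) int in auto)
  qed
  ultimately show ?thesis by (simp add: U.prob_space[simplified])
qed

end

section \<open>Series for the limiting integrals\<close>

text \<open>Euler's Beta integral \<open>B(m + 1, d + 1)\<close>. Integration by parts trades a
  factor \<open>1 - u\<close> for a factor \<open>u\<close>, which lowers \<open>d\<close> and
  raises \<open>m\<close>.\<close>

lemma has_integral_beta_nat:
  "((\<lambda>u. u ^ m * (1 - u) ^ d) has_integral fact d / pochhammer (real (Suc m)) (Suc d)) {0..1::real}"
proof (induction d arbitrary: m)
  case 0
  have "((\<lambda>u. u ^ m) has_integral (1 ^ Suc m / Suc m - 0 ^ Suc m / Suc m)) {0..1::real}"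
    by (intro fundamental_theorem_of_calculus)
       (auto intro!: derivative_eq_intros simp del: power_Suc of_nat_Suc
          simp flip: has_real_derivative_iff_has_vector_derivative)
  then show ?case by simp
next
  case (Suc d)
  define k :: real where "k = Suc d / Suc m"
  let ?F = "\<lambda>u::real. u ^ Suc m * (1 - u) ^ Suc d / Suc m"
  have "((\<lambda>u. u ^ m * (1 - u) ^ Suc d - k * (u ^ Suc m * (1 - u) ^ d)) has_integral (?F 1 - ?F 0)) {0..1}"
  proof (intro fundamental_theorem_of_calculus)
    fix u :: real
    have eq: "(real (Suc m) * u ^ m * (1 - u) ^ Suc d - u ^ Suc m * (real (Suc d) * (1 - u) ^ d)) / Suc m
       = u ^ m * (1 - u) ^ Suc d - k * (u ^ Suc m * (1 - u) ^ d)"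
      unfolding k_def by (simp add: diff_divide_distrib del: power_Suc)
    have "(?F has_real_derivative
        (real (Suc m) * u ^ m * (1 - u) ^ Suc d - u ^ Suc m * (real (Suc d) * (1 - u) ^ d)) / Suc m)
        (at u within {0..1})"
      by (rule DERIV_cdivide)
         (auto intro!: derivative_eq_intros simp del: power_Suc of_nat_Suc simp: algebra_simps)
    then show "(?F has_vector_derivative u ^ m * (1 - u) ^ Suc d - k * (u ^ Suc m * (1 - u) ^ d)) (at u within {0..1})"
      unfolding eq by (simp only: has_real_derivative_iff_has_vector_derivative)
  qed simp
  from has_integral_add[OF this has_integral_mult_right[OF Suc.IH[of "Suc m"], of k]]
  have "((\<lambda>u. u ^ m * (1 - u) ^ Suc d) has_integral
      k * (fact d / pochhammer (real (Suc (Suc m))) (Suc d))) {0..1}"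
    by simp
  also have "k * (fact d / pochhammer (real (Suc (Suc m))) (Suc d))
      = fact (Suc d) / pochhammer (real (Suc m)) (Suc (Suc d))"
    by (subst (2) pochhammer_rec) (simp add: k_def add.commute)
  finally show ?case .
qed

lemma geometric_remainder:
  fixes y :: real
  assumes "y \<noteq> 1"
  shows "1 / (1 - y) = (\<Sum>d<N. y ^ d) + y ^ N / (1 - y)"
  using assms by (simp add: sum_gp_strict field_simps)

text \<open>Geometric expansion in \<open>r * (1 - u)\<close>, integrated term by term. The value
  \<open>r = -1\<close> occurs for the smallest weight with \<open>a = 0\<close>; there the
  expansion diverges at \<open>u = 0\<close>, so the exchange rests on the integral of the
  remainder, which is of order \<open>1 / N\<close>.\<close>

lemma geometric_beta_series:
  fixes r :: real and m :: nat
  assumes r: "-1 \<le> r" "r < 1"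
  defines "f \<equiv> \<lambda>d. r ^ d * fact d / pochhammer (real (Suc m)) (Suc d)"
  shows "f sums integral {0..1} (\<lambda>u. u ^ m / (1 - r * (1 - u)))"
    and "(\<lambda>u. u ^ m / (1 - r * (1 - u))) integrable_on {0..1}"
proof -
  \<comment> \<open>The minimum of the denominator on the unit interval, attained at
    \<open>u = 1\<close> for \<open>r \<le> 0\<close> and at \<open>u = 0\<close> otherwise.\<close>
  define c where "c = (if r \<le> 0 then 1 else 1 - r)"
  have "0 < c" using r by (simp add: c_def)
  have den: "c \<le> 1 - r * (1 - u)" if "u \<in> {0..1}" for u
  proof (cases "r \<le> 0")
    case True
    then show ?thesis using that mult_nonpos_nonneg[of r "1 - u"] by (simp add: c_def)
  next
    case False
    then show ?thesis using that mult_left_le[of "1 - u" r] by (simp add: c_def)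
  qed
  then have ne: "1 - r * (1 - u) \<noteq> 0" if "u \<in> {0..1}" for u
    using that \<open>0 < c\<close> by (metis not_le)
  let ?g = "\<lambda>u. u ^ m / (1 - r * (1 - u))"
  show int: "?g integrable_on {0..1}"
    using ne by (intro integrable_continuous_interval continuous_intros) auto
  have partial: "((\<lambda>u. \<Sum>d<N. r ^ d * (u ^ m * (1 - u) ^ d)) has_integral (\<Sum>d<N. f d)) {0..1}" for N
    unfolding f_def times_divide_eq_right[symmetric]
    by (intro has_integral_sum has_integral_mult_right has_integral_beta_nat) auto
  have bound: "\<bar>integral {0..1} ?g - (\<Sum>d<N. f d)\<bar> \<le> 1 / (c * Suc N)" for N
  proof -
    have A: "((\<lambda>u. ?g u - (\<Sum>d<N. r ^ d * (u ^ m * (1 - u) ^ d))) has_integral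
        (integral {0..1} ?g - (\<Sum>d<N. f d))) {0..1}"
      by (intro has_integral_diff partial integrable_integral int)
    \<comment> \<open>The majorant of the remainder, written with \<open>u ^ 0\<close> to match the
      Beta integral; its integral is \<open>1 / (c * (N + 1))\<close>.\<close>
    have B: "((\<lambda>u. u ^ 0 * (1 - u) ^ N * (1 / c)) has_integral
        fact N / pochhammer (real (Suc 0)) (Suc N) * (1 / c)) {0..1}"
      by (intro has_integral_mult_left has_integral_beta_nat)
    have "norm (?g u - (\<Sum>d<N. r ^ d * (u ^ m * (1 - u) ^ d))) \<le> u ^ 0 * (1 - u) ^ N * (1 / c)"
      if u: "u \<in> {0..1}" for u
    proof -
      have "?g u = u ^ m * (1 / (1 - r * (1 - u)))" by simp
      also have "\<dots> = u ^ m * ((\<Sum>d<N. (r * (1 - u)) ^ d) + (r * (1 - u)) ^ N / (1 - r * (1 - u)))"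
        using ne[OF u] by (subst geometric_remainder[of _ N]) auto
      finally have "?g u - (\<Sum>d<N. r ^ d * (u ^ m * (1 - u) ^ d)) = u ^ m * (r ^ N * (1 - u) ^ N / (1 - r * (1 - u)))"
        by (simp add: distrib_left sum_distrib_left power_mult_distrib mult_ac)
      also have "norm \<dots> = u ^ m * \<bar>r\<bar> ^ N * ((1 - u) ^ N / \<bar>1 - r * (1 - u)\<bar>)"
        using u by (simp add: abs_mult power_abs)
      also have "\<dots> \<le> 1 * ((1 - u) ^ N / c)"
      proof (intro mult_mono frac_le)
        have "u ^ m \<le> 1" "\<bar>r\<bar> ^ N \<le> 1" using u r by (auto intro!: power_le_one)
        then show "u ^ m * \<bar>r\<bar> ^ N \<le> 1" using u by (intro mult_le_one) auto
        show "c \<le> \<bar>1 - r * (1 - u)\<bar>" using den[OF u] by simp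
      qed (use u \<open>0 < c\<close> in auto)
      finally show ?thesis by simp
    qed
    then have "norm (integral {0..1} ?g - (\<Sum>d<N. f d)) \<le> fact N / pochhammer (real (Suc 0)) (Suc N) * (1 / c)"
      using integral_norm_bound_integral[OF has_integral_integrable[OF A] has_integral_integrable[OF B]]
      unfolding integral_unique[OF A] integral_unique[OF B] by blast
    moreover have "pochhammer (real (Suc 0)) (Suc N) = real (Suc N) * fact N"
      using pochhammer_fact[of "Suc N", where 'a = real] by simp
    ultimately show ?thesis by (simp add: mult.commute)
  qed
  have "(\<lambda>N. \<Sum>d<N. f d) \<longlonglongrightarrow> integral {0..1} ?g"
  proof (rule LIM_zero_cancel, rule Lim_null_comparison)
    show "\<forall>\<^sub>F N in sequentially. norm ((\<Sum>d<N. f d) - integral {0..1} ?g) \<le> 1 / (c * Suc N)"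
      using bound by (auto simp: abs_minus_commute)
    have "(\<lambda>N. 1 / c * inverse (real (Suc N))) \<longlonglongrightarrow> 1 / c * 0"
      by (intro tendsto_mult tendsto_const LIMSEQ_inverse_real_of_nat)
    then show "(\<lambda>N. 1 / (c * real (Suc N))) \<longlonglongrightarrow> 0" by (simp add: field_simps)
  qed
  then show "f sums integral {0..1} ?g" by (simp add: sums_def)
qed

lemma has_integral_unit_interval_affine:
  fixes G :: "real \<Rightarrow> real"
  assumes "(G has_integral V) (cbox 0 1)" "x \<noteq> y"
  shows "((\<lambda>t. G ((t - x) / (y - x))) has_integral \<bar>y - x\<bar> * V) ((\<lambda>u. (y - x) * u + x) ` {0..1})"
proof -
  have eq: "1 / (y - x) * t + - x / (y - x) = (t - x) / (y - x)" for t
    by (simp add: diff_divide_distrib)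
  have "y - x \<noteq> 0" using assms by simp
  then show ?thesis
    using has_integral_affinity[OF assms(1), of "1 / (y - x)" "- x / (y - x)"]
    unfolding real_scaleR_def eq by simp
qed

text \<open>Here \<open>x\<close> is the end of the interval at which the power vanishes, and \<open>y\<close> is the other end;
the substitution \<open>t = x + (y - x) u\<close> turns \<open>x + t\<close> into \<open>(x + y) (1 - r (1 - u))\<close>.\<close>

lemma extremal_integral_series:
  fixes x y :: real and m :: nat
  assumes "0 < x" "0 \<le> y" "x \<noteq> y"
  defines "r \<equiv> (y - x) / (x + y)"
  defines "f \<equiv> \<lambda>d. r ^ Suc d * fact (Suc d) / pochhammer (real (Suc m)) (Suc (Suc d))"
  shows "summable f"
    and "1 / \<bar>y - x\<bar> * integral {min x y..max x y} (\<lambda>t. ((t - x) / (y - x)) ^ m * (2 * t / (x + t)))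
      = 2 * y / (x + y) * (1 / real (Suc m)) - 2 * x / (x + y) * suminf f"
proof -
  have xy: "0 < x + y" using assms by simp
  have r: "-1 \<le> r" "r < 1" using assms by (auto simp: r_def field_simps)
  define h where "h d = r ^ d * fact d / pochhammer (real (Suc m)) (Suc d)" for d
  let ?g = "\<lambda>u. u ^ m / (1 - r * (1 - u))"
  have sums: "h sums integral {0..1} ?g" and int: "?g integrable_on {0..1}"
    using geometric_beta_series[OF r, of m] unfolding h_def by auto
  have f_eq: "f = (\<lambda>d. h (Suc d))" by (simp add: f_def h_def)
  have "summable h" using sums by (rule sums_summable)
  then show "summable f" unfolding f_eq by (subst summable_Suc_iff)
  have split: "integral {0..1} ?g = 1 / real (Suc m) + suminf f"
    using suminf_split_head[OF \<open>summable h\<close>] sums_unique[OF sums] by (simp add: f_eq h_def)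
  \<comment> \<open>This rests on \<open>2 * t / (x + t) = 2 - 2 * x / (x + t)\<close>. The factor
    \<open>(1 - u) ^ 0\<close> fits the constant part to the Beta integral; its value
    \<open>2 / (m + 1)\<close> and the leading term of the series combine to the coefficient
    \<open>2 * y / (x + y)\<close>.\<close>
  have "((\<lambda>u. 2 * (u ^ m * (1 - u) ^ 0) - 2 * x / (x + y) * ?g u) has_integral
      2 * (fact 0 / pochhammer (real (Suc m)) (Suc 0)) - 2 * x / (x + y) * integral {0..1} ?g) {0..1}"
    by (intro has_integral_diff has_integral_mult_right has_integral_beta_nat integrable_integral int)
  also have "2 * (fact 0 / pochhammer (real (Suc m)) (Suc 0)) - 2 * x / (x + y) * integral {0..1} ?g
      = 2 * y / (x + y) * (1 / real (Suc m)) - 2 * x / (x + y) * suminf f" (is "_ = ?V")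
  proof -
    have "2 - 2 * x / (x + y) = 2 * y / (x + y)" using xy by (simp add: field_simps)
    then have "2 * (1 / real (Suc m)) - 2 * x / (x + y) * (1 / real (Suc m)) = 2 * y / (x + y) * (1 / real (Suc m))"
      by (metis left_diff_distrib)
    then show ?thesis unfolding split by (simp add: distrib_left)
  qed
  finally have "((\<lambda>u. 2 * (u ^ m * (1 - u) ^ 0) - 2 * x / (x + y) * ?g u) has_integral ?V) (cbox 0 1)" by simp
  then have "((\<lambda>t. 2 * (((t - x) / (y - x)) ^ m * (1 - (t - x) / (y - x)) ^ 0)
      - 2 * x / (x + y) * ?g ((t - x) / (y - x))) has_integral \<bar>y - x\<bar> * ?V) ((\<lambda>u. (y - x) * u + x) ` {0..1})"
    by (rule has_integral_unit_interval_affine) fact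
  also have "(\<lambda>u. (y - x) * u + x) ` {0..1} = {min x y..max x y}"
    using assms(3) by (cases "x < y") (auto simp: image_affinity_atLeastAtMost min_def max_def)
  finally have "((\<lambda>t. ((t - x) / (y - x)) ^ m * (2 * t / (x + t))) has_integral \<bar>y - x\<bar> * ?V) {min x y..max x y}"
  proof (rule has_integral_eq[rotated])
    fix t assume "t \<in> {min x y..max x y}"
    then have t: "0 < x + t" using assms by auto
    have "2 * x / p * (W / (q / p)) = W * (2 * x / q)" if "p \<noteq> 0" "q \<noteq> 0" for p q W :: real
      using that by (simp add: field_simps)
    then have cancel: "2 * x / (x + y) * (W / ((x + t) / (x + y))) = W * (2 * x / (x + t))" for W
      using xy t by simp
    define w where "w = (t - x) / (y - x)"
    have "1 - w = (y - t) / (y - x)" using assms(3) by (simp add: w_def field_simps)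
    then have "r * (1 - w) = (y - t) / (x + y)" using assms(3) by (simp add: r_def)
    then have den: "1 - r * (1 - w) = (x + t) / (x + y)" using xy by (simp add: field_simps)
    have "2 * (w ^ m * (1 - w) ^ 0) - 2 * x / (x + y) * (w ^ m / (1 - r * (1 - w))) = w ^ m * (2 - 2 * x / (x + t))"
      unfolding den cancel by (simp add: algebra_simps)
    also have "2 - 2 * x / (x + t) = 2 * t / (x + t)" using t by (simp add: field_simps)
    finally show "2 * (((t - x) / (y - x)) ^ m * (1 - (t - x) / (y - x)) ^ 0) - 2 * x / (x + y) * ?g ((t - x) / (y - x))
        = ((t - x) / (y - x)) ^ m * (2 * t / (x + t))" unfolding w_def .
  qed
  then show "1 / \<bar>y - x\<bar> * integral {min x y..max x y} (\<lambda>t. ((t - x) / (y - x)) ^ m * (2 * t / (x + t))) = ?V"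
    using assms(3) by (simp add: integral_unique)
qed

text \<open>The case \<open>x = 0\<close> that \<open>extremal_integral_series\<close> excludes,
  where the ratio \<open>r\<close> would be 1. Away from \<open>t = 0\<close>, where the quotient is
  a division by zero, the integrand is \<open>2 * (t / b) ^ m\<close>.\<close>

lemma max_integral_zero:
  fixes b :: real
  assumes "0 < b"
  shows "1 / b * integral {0..b} (\<lambda>t. (t / b) ^ m * (2 * t / t)) = 2 / real (Suc m)"
proof -
  have "((\<lambda>t. 2 / b ^ m * t ^ m) has_integral
      (2 / b ^ m * (b ^ Suc m / Suc m) - 2 / b ^ m * (0 ^ Suc m / Suc m))) {0..b}"
    using assms by (intro fundamental_theorem_of_calculus)
       (auto intro!: derivative_eq_intros simp del: power_Suc of_nat_Suc simp flip: has_real_derivative_iff_has_vector_derivative)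
  then have "((\<lambda>t. (t / b) ^ m * (2 * t / t)) has_integral
      (2 / b ^ m * (b ^ Suc m / Suc m) - 2 / b ^ m * (0 ^ Suc m / Suc m))) {0..b}"
    by (rule has_integral_spike[of "{0}", rotated 2]) (auto simp: power_divide)
  then show ?thesis using assms by (simp add: integral_unique)
qed

section \<open>Error bounds\<close>

text \<open>The contraction sees \<open>c\<close>, \<open>d\<close> and \<open>h\<close> only
  through the number of spreading steps, the block length and the initial oscillation, and each of
  these is controlled by \<open>\<delta>\<close> and \<open>B\<close>.\<close>

lemma renewal_rate_uniform:
  assumes "0 < \<delta>" "0 < B"
  obtains C \<gamma> where "0 < C" "0 < \<gamma>"
    "\<And>c d h x. 0 \<le> c \<Longrightarrow> \<delta> \<le> d - c \<Longrightarrow> d \<le> B \<Longrightarrow> 0 \<le> h \<Longrightarrow> h \<le> B \<Longrightarrow>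
      \<bar>uniform_renewal.G c d h x - 2 * h / (c + d)\<bar> \<le> C * exp (- \<gamma> * x)"
proof -
  \<comment> \<open>\<open>R\<close> majorizes the block length \<open>(m + 3) * d\<close>,
    \<open>\<rho>\<close> is the factor gained per block, and \<open>M\<close> majorizes the initial
    oscillation by \<open>1 + 4 * B / \<delta> + 2 * B / \<delta>\<close>, as
    \<open>c + d \<ge> \<delta>\<close>.\<close>
  define m where "m = nat \<lceil>2 * B / \<delta>\<rceil>"
  define R where "R = (real m + 3) * B"
  define \<rho> where "\<rho> = 1 - 1 / (2 * 16 ^ m :: real)"
  define M where "M = 1 + 6 * B / \<delta>"
  define \<gamma> where "\<gamma> = - ln \<rho> / R"
  have "R > 0" using assms by (simp add: R_def)
  have "2 * 16 ^ m > (1::real)" using one_le_power[of "16::real" m] by linarith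
  then have \<rho>: "0 < \<rho>" "\<rho> < 1" by (simp_all add: \<rho>_def)
  have "M > 0" using assms by (simp add: M_def add_pos_nonneg)
  have "\<gamma> > 0" using \<rho> \<open>R > 0\<close> by (simp add: \<gamma>_def divide_neg_pos ln_less_zero)
  show thesis
  \<comment> \<open>The factor \<open>exp (\<gamma> * (B + R))\<close> pays for the start at
    \<open>h \<le> B\<close> and for rounding down to whole blocks.\<close>
  proof (rule that[of "M * exp (\<gamma> * (B + R))" \<gamma>])
    fix c d h x :: real
    assume cdh: "0 \<le> c" "\<delta> \<le> d - c" "d \<le> B" "0 \<le> h" "h \<le> B"
    interpret uniform_renewal c d h using cdh assms by unfold_locales auto
    \<comment> \<open>The number of whole blocks between \<open>h\<close> and \<open>x\<close>; for
      \<open>x < h\<close> it is 0 by truncation.\<close>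
    define j where "j = nat \<lfloor>(x - h) / R\<rfloor>"
    have m: "2 * d \<le> m * (d - c)"
    proof -
      have "2 * d \<le> 2 * B" using cdh by simp
      also have "\<dots> = 2 * B / \<delta> * \<delta>" using assms by simp
      also have "2 * B / \<delta> \<le> m" unfolding m_def by (rule real_nat_ceiling_ge)
      then have "2 * B / \<delta> * \<delta> \<le> m * (d - c)" using cdh assms by (intro mult_mono) auto
      finally show ?thesis .
    qed
    have M: "1 + 4 * h / (d - c) + L \<le> M"
    proof -
      have "4 * h / (d - c) \<le> 4 * B / \<delta>" "2 * h / (c + d) \<le> 2 * B / \<delta>"
        using cdh assms by (auto intro!: frac_le)
      then show ?thesis by (simp add: M_def L_def)
    qed
    have "\<bar>G x - L\<bar> \<le> \<rho> ^ j * M"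
    proof (cases "h \<le> x")
      case True
      have "h + j * ((real m + 3) * d) \<le> h + j * R"
        unfolding R_def using cdh by (intro add_left_mono mult_left_mono) auto
      also have "real j \<le> (x - h) / R"
        using True \<open>R > 0\<close> by (simp add: j_def)
      then have "h + j * R \<le> x" using \<open>R > 0\<close> by (simp add: field_simps)
      finally have "\<bar>G x - L\<bar> \<le> \<rho> ^ j * (1 + 4 * h / (d - c) + L)"
        unfolding \<rho>_def by (rule G_contraction[OF m])
      also have "\<dots> \<le> \<rho> ^ j * M" using M \<rho> by (intro mult_left_mono) auto
      finally show ?thesis .
    next
      case False
      then have "(x - h) / R < 0" using \<open>R > 0\<close> by (simp add: divide_neg_pos)
      then have "j = 0" by (simp add: j_def)
      then show ?thesis using G_minus_L_le[of x] M by simp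
    qed
    also have "\<rho> ^ j \<le> exp (\<gamma> * (B + R)) * exp (- \<gamma> * x)"
    proof -
      have "(x - h) / R - 1 \<le> j" unfolding j_def by linarith
      then have "x - h - R \<le> j * R" using \<open>R > 0\<close> by (simp add: field_simps)
      then have "\<gamma> * (x - B - R) \<le> \<gamma> * (j * R)" using \<open>\<gamma> > 0\<close> cdh by (intro mult_left_mono) auto
      also have "\<dots> = - (j * ln \<rho>)" using \<open>R > 0\<close> by (simp add: \<gamma>_def)
      finally have "j * ln \<rho> \<le> \<gamma> * (B + R) + - \<gamma> * x" by (simp add: algebra_simps)
      then have "exp (j * ln \<rho>) \<le> exp (\<gamma> * (B + R)) * exp (- \<gamma> * x)"
        by (simp add: exp_add[symmetric])
      then show ?thesis using \<rho> by (simp add: exp_of_nat_mult)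
    qed
    finally show "\<bar>G x - 2 * h / (c + d)\<bar> \<le> M * exp (\<gamma> * (B + R)) * exp (- \<gamma> * x)"
      using \<open>M > 0\<close> by (simp add: L_def mult_ac)
  qed (use \<open>M > 0\<close> \<open>\<gamma> > 0\<close> in auto)
qed

text \<open>Keeps the geometric factor of the tail polynomial in \<open>1 / y\<close>, which matters
  when the Chernoff parameter shrinks with \<open>n\<close>.\<close>

lemma inverse_one_minus_exp_le:
  fixes y :: real
  assumes "0 < y"
  shows "1 / (1 - exp (- y)) \<le> 1 + 1 / y"
proof -
  have "exp (- y) \<le> 1 / (1 + y)"
    using exp_ge_add_one_self[of y] assms by (simp add: exp_minus field_simps)
  then have "y / (1 + y) \<le> 1 - exp (- y)" using assms by (simp add: field_simps)
  then have "1 / (1 - exp (- y)) \<le> 1 / (y / (1 + y))" using assms by (intro divide_left_mono) auto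
  also have "\<dots> = 1 + 1 / y" using assms by (simp add: field_simps)
  finally show ?thesis .
qed

text \<open>The sharper \<open>mgf_le\<close> is kept in the \<open>n\<close>-th power, where it
  decides the exponent; the cruder \<open>mgf_le_half\<close> serves for the geometric factor
  \<open>1 / (1 - mgf \<theta>)\<close>.\<close>

lemma (in uniform_renewal) tail_le_exp:
  assumes "0 < \<theta>" "\<theta> * d\<^sup>2 \<le> (c + d) / 2"
  shows "\<bar>(\<Sum>k<n. u k x) - G x\<bar>
    \<le> exp (\<theta> * (x - n * ((c + d) / 2)) + n * (\<theta>\<^sup>2 * d\<^sup>2 / 2)) * (1 + 4 / (\<theta> * (c + d)))"
proof -
  let ?y = "\<theta> * (c + d) / 4"
  have y: "0 < ?y" using assms cd_pos by simp
  have half: "mgf \<theta> \<le> exp (- ?y)" using mgf_le_half[of \<theta>] assms by (simp add: mult.commute)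
  also have "exp (- ?y) < 1" using y by simp
  finally have lt: "mgf \<theta> < 1" .
  have "\<bar>(\<Sum>k<n. u k x) - G x\<bar> \<le> exp (\<theta> * x) * mgf \<theta> ^ n * (1 / (1 - mgf \<theta>))"
    using tail_le[where \<theta> = \<theta> and n = n and x = x] assms lt by simp
  also have "\<dots> \<le> (exp (\<theta> * x) * exp (- \<theta> * ((c + d) / 2) + \<theta>\<^sup>2 * d\<^sup>2 / 2) ^ n) * (1 + 1 / ?y)"
  proof (intro mult_mono order_refl power_mono mgf_le mgf_nonneg)
    have "1 / (1 - mgf \<theta>) \<le> 1 / (1 - exp (- ?y))"
    proof (rule divide_left_mono)
      have "0 < 1 - mgf \<theta>" "0 < 1 - exp (- ?y)" using lt \<open>exp (- ?y) < 1\<close> by linarith+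
      then show "0 < (1 - mgf \<theta>) * (1 - exp (- ?y))" by (rule mult_pos_pos)
    qed (use half in auto)
    also have "\<dots> \<le> 1 + 1 / ?y" by (rule inverse_one_minus_exp_le[OF y])
    finally show "1 / (1 - mgf \<theta>) \<le> 1 + 1 / ?y" .
  qed (use assms lt mgf_nonneg in auto)
  also have "exp (\<theta> * x) * exp (- \<theta> * ((c + d) / 2) + \<theta>\<^sup>2 * d\<^sup>2 / 2) ^ n
      = exp (\<theta> * (x - n * ((c + d) / 2)) + n * (\<theta>\<^sup>2 * d\<^sup>2 / 2))"
    unfolding exp_of_nat_mult[symmetric] exp_add[symmetric] by (simp add: field_simps)
  finally show ?thesis by simp
qed

text \<open>Where \<open>P\<close> fails, the trivial estimate is used: the sum has \<open>n\<close>
  terms in \<open>[0, 1]\<close>, so the error is at most \<open>n + 2\<close>, and the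
  exponentially small \<open>p t ^ (n - 1)\<close> compensates for it.\<close>

lemma (in extremal_weight) exp_shapley_approx_two_regimes:
  assumes "0 < n" and "\<sigma> = 1 \<and> k = n - 1 \<or> \<sigma> = -1 \<and> k = 0"
    and meas: "p \<in> borel_measurable borel" "l \<in> borel_measurable borel"
    and p: "\<And>t. t \<in> {a..b} \<Longrightarrow> 0 \<le> p t \<and> p t \<le> 1"
    and l: "\<And>t. t \<in> {a..b} \<Longrightarrow> \<bar>l t\<bar> \<le> 2"
    and good: "\<And>t. a < t \<Longrightarrow> t < b \<Longrightarrow> P t \<Longrightarrow> \<bar>(\<Sum>m<n. window_prob (lo t) (hi t) t m Q) - l t\<bar> \<le> e"
    and bad: "\<And>t. a < t \<Longrightarrow> t < b \<Longrightarrow> \<not> P t \<Longrightarrow> p t \<le> \<rho>" and "0 \<le> \<rho>" "0 \<le> e"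
  shows "\<bar>exp_shapley n a b k Q - 1 / (b - a) * integral {a..b} (\<lambda>t. p t ^ (n - 1) * l t)\<bar>
    \<le> e + (real n + 2) * \<rho> ^ (n - 1)"
proof (rule exp_shapley_approx[OF assms(1,2) meas])
  have pp: "0 \<le> p t ^ (n - 1) \<and> p t ^ (n - 1) \<le> 1" if "t \<in> {a..b}" for t
    using p[OF that] by (auto intro: power_le_one)
  show "\<bar>p t ^ (n - 1) * l t\<bar> \<le> 1 * 2" if "t \<in> {a..b}" for t
    unfolding abs_mult using pp[OF that] l[OF that] by (intro mult_mono) auto
  fix t assume t: "a < t" "t < b"
  let ?S = "\<Sum>m<n. window_prob (lo t) (hi t) t m Q"
  have tt: "t \<in> {a..b}" using t by simp
  have eq: "\<bar>p t ^ (n - 1) * (?S - l t)\<bar> = p t ^ (n - 1) * \<bar>?S - l t\<bar>"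
    using pp[OF tt] by (simp add: abs_mult)
  show "\<bar>p t ^ (n - 1) * (?S - l t)\<bar> \<le> e + (real n + 2) * \<rho> ^ (n - 1)"
  proof (cases "P t")
    case True
    have "p t ^ (n - 1) * \<bar>?S - l t\<bar> \<le> 1 * e"
      using pp[OF tt] good[OF t True] by (intro mult_mono) auto
    moreover have "0 \<le> (real n + 2) * \<rho> ^ (n - 1)" using \<open>0 \<le> \<rho>\<close> by simp
    ultimately show ?thesis using eq by simp
  next
    case False
    interpret R: uniform_renewal "lo t" "hi t" t
      using range[OF t] a_nonneg t by unfold_locales auto
    have "0 \<le> ?S" using R.u_nonneg by (intro sum_nonneg)
    moreover have "?S \<le> (\<Sum>m<n. 1)" using R.u_le_1 by (intro sum_mono)
    ultimately have "\<bar>?S - l t\<bar> \<le> n + 2" using l[OF tt] by simp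
    then have "p t ^ (n - 1) * \<bar>?S - l t\<bar> \<le> \<rho> ^ (n - 1) * (real n + 2)"
      using p[OF tt] bad[OF t False] \<open>0 \<le> \<rho>\<close> by (intro mult_mono power_mono) auto
    also have "\<dots> = (real n + 2) * \<rho> ^ (n - 1)" by (rule mult.commute)
    finally show ?thesis using eq \<open>0 \<le> e\<close> by linarith
  qed
qed

lemma linear_exp_le:
  fixes \<alpha> v :: real
  assumes "0 < \<alpha>"
  shows "v * exp (- \<alpha> * v) \<le> 2 / \<alpha> * exp (- (\<alpha> / 2) * v)"
proof -
  have "\<alpha> / 2 * v \<le> exp (\<alpha> / 2 * v)" using exp_ge_add_one_self[of "\<alpha> / 2 * v"] by linarith
  then have "v \<le> 2 / \<alpha> * exp (\<alpha> / 2 * v)" using assms by (simp add: field_simps)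
  then have "v * exp (- \<alpha> * v) \<le> 2 / \<alpha> * exp (\<alpha> / 2 * v) * exp (- \<alpha> * v)"
    by (intro mult_right_mono) auto
  also have "\<dots> = 2 / \<alpha> * exp (- (\<alpha> / 2) * v)"
    by (simp add: exp_add[symmetric] field_simps)
  finally show ?thesis .
qed

lemma bad_regime_le:
  assumes "0 < \<rho>" "\<rho> < 1"
  obtains C \<gamma> where "0 < C" "0 < \<gamma>"
    "\<And>n w. 1 \<le> n \<Longrightarrow> w \<le> real n \<Longrightarrow> (real n + 2) * \<rho> ^ (n - 1) \<le> C * exp (- \<gamma> * w)"
proof -
  define \<beta> where "\<beta> = - ln \<rho>"
  have \<beta>: "0 < \<beta>" using assms by (simp add: \<beta>_def ln_less_zero)
  show thesis
  proof (rule that[of "(2 / \<beta> + 2) / \<rho>" "\<beta> / 2"])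
    fix n :: nat and w :: real
    assume n: "1 \<le> n" "w \<le> real n"
    have "\<rho> ^ n = exp (real n * ln \<rho>)" using assms by (simp add: exp_of_nat_mult)
    also have "\<dots> = exp (- \<beta> * n)" by (simp add: \<beta>_def mult.commute)
    finally have "\<rho> ^ n = exp (- \<beta> * n)" .
    moreover have "\<rho> ^ n = \<rho> * \<rho> ^ (n - 1)" using n by (cases n) auto
    ultimately have "\<rho> ^ (n - 1) = exp (- \<beta> * n) / \<rho>"
      using assms by (simp add: field_simps)
    then have "(real n + 2) * \<rho> ^ (n - 1) = (n * exp (- \<beta> * n) + 2 * exp (- \<beta> * n)) / \<rho>"
      by (simp add: distrib_right)
    also have "\<dots> \<le> (2 / \<beta> * exp (- (\<beta> / 2) * n) + 2 * exp (- (\<beta> / 2) * n)) / \<rho>"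
      using linear_exp_le[OF \<beta>, of n] \<beta> assms by (intro divide_right_mono add_mono) auto
    also have "\<dots> = (2 / \<beta> + 2) / \<rho> * exp (- (\<beta> / 2) * n)" by (simp add: field_simps)
    also have "\<dots> \<le> (2 / \<beta> + 2) / \<rho> * exp (- (\<beta> / 2) * w)"
      using n \<beta> assms by (intro mult_left_mono) auto
    finally show "(real n + 2) * \<rho> ^ (n - 1) \<le> (2 / \<beta> + 2) / \<rho> * exp (- (\<beta> / 2) * w)" .
  qed (use \<beta> assms in \<open>auto intro!: divide_pos_pos add_pos_pos\<close>)
qed

text \<open>The source of the exponent 1/4: the renewal error decays exponentially in the quota, and
  the smallest admissible quota is \<open>n powr (1/4) * \<mu>\<close>.\<close>

lemma quota_lower:
  assumes "1 \<le> n" "real n powr (-3/4) \<le> q" "0 \<le> \<mu>"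
  shows "real n powr (1/4) * \<mu> \<le> q * real n * \<mu>"
proof -
  have "real n powr (1/4) = real n powr (-3/4) * real n powr 1"
    by (subst powr_add[symmetric]) simp
  also have "\<dots> \<le> q * real n" using assms order_trans[OF powr_ge_zero assms(2)] by (intro mult_mono) auto
  finally show ?thesis using assms by (intro mult_right_mono) auto
qed

lemma exp_sum3_le:
  fixes w :: real
  assumes "0 \<le> w" "0 \<le> C1" "0 \<le> C2" "0 \<le> C3"
    "e1 \<le> C1 * exp (- g1 * w)" "e2 \<le> C2 * exp (- g2 * w)" "e3 \<le> C3 * exp (- g3 * w)"
  shows "e1 + e2 + e3 \<le> (C1 + C2 + C3) * exp (- Min {g1, g2, g3} * w)"
proof -
  let ?g = "Min {g1, g2, g3}"
  have "C * exp (- g * w) \<le> C * exp (- ?g * w)" if "g \<in> {g1, g2, g3}" "0 \<le> C" for g C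
    using that assms(1) by (intro mult_left_mono) (auto intro!: mult_right_mono)
  from this[of g1 C1] this[of g2 C2] this[of g3 C3] show ?thesis
    using assms by (simp add: distrib_right)
qed


lemma powr_quarter_le:
  assumes "1 \<le> n"
  shows "real n powr (1/4) \<le> real n" "real n powr (1/4) \<le> real n powr (1/3)"
proof -
  have "real n powr (1/4) \<le> real n powr 1" using assms by (intro powr_mono) auto
  then show "real n powr (1/4) \<le> real n" by simp
  show "real n powr (1/4) \<le> real n powr (1/3)" using assms by (intro powr_mono) auto
qed

lemma exp_shapley_max_approx:
  fixes a b \<epsilon> :: real
  assumes ab: "0 \<le> a" "a < b" and "0 < \<epsilon>"
  obtains C \<gamma> where "0 < C" "0 < \<gamma>"
    "\<And>n q. 1 \<le> n \<Longrightarrow> real n powr (-3/4) \<le> q \<Longrightarrow> q \<le> 1 - \<epsilon> \<Longrightarrow>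
      \<bar>exp_shapley n a b (n - 1) (q * real n * mean_unif a b)
        - 1 / (b - a) * integral {a..b} (\<lambda>t. ((t - a) / (b - a)) ^ (n - 1) * (2 * t / (a + t)))\<bar>
      \<le> C * exp (- \<gamma> * real n powr (1/4))"
proof -
  define \<mu> where "\<mu> = (a + b) / 2"
  define \<epsilon>' where "\<epsilon>' = min \<epsilon> 1"
  \<comment> \<open>The first bound keeps the step interval \<open>[a, t]\<close> at least half as
    long as \<open>[a, b]\<close>; the second keeps the mean step above
    \<open>\<mu> - \<epsilon>' * \<mu> / 4\<close>, which uses up a quarter of the gap left by the
    quota.\<close>
  define \<delta> where "\<delta> = min ((b - a) / 2) (\<epsilon>' * \<mu> / 2)"
  \<comment> \<open>Makes the quadratic Chernoff loss at most \<open>1/8\<close> of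
    \<open>\<theta> * n * \<epsilon>' * \<mu>\<close>, against a linear gain of \<open>3/4\<close>
    of it.\<close>
  define \<theta> where "\<theta> = \<epsilon>' * \<mu> / (4 * b\<^sup>2)"
  have b: "0 < b" using ab by simp
  have \<mu>: "0 < \<mu>" using ab by (simp add: \<mu>_def)
  have \<epsilon>': "0 < \<epsilon>'" "\<epsilon>' \<le> 1" "\<epsilon>' \<le> \<epsilon>" using \<open>0 < \<epsilon>\<close> by (auto simp: \<epsilon>'_def)
  have \<delta>: "0 < \<delta>" "\<delta> \<le> (b - a) / 2" "\<delta> \<le> \<epsilon>' * \<mu> / 2"
  proof -
    show "0 < \<delta>" using ab \<epsilon>' \<mu> by (simp add: \<delta>_def)
    show "\<delta> \<le> (b - a) / 2" unfolding \<delta>_def by (rule min.cobounded1)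
    show "\<delta> \<le> \<epsilon>' * \<mu> / 2" unfolding \<delta>_def by (rule min.cobounded2)
  qed
  have \<theta>: "0 < \<theta>" using \<epsilon>' \<mu> b by (simp add: \<theta>_def)
  have \<theta>b: "\<theta> * b\<^sup>2 = \<epsilon>' * \<mu> / 4" using b by (simp add: \<theta>_def)
  obtain C1 \<gamma>1 where C1: "0 < C1" "0 < \<gamma>1" and rate:
    "\<And>c d h x. 0 \<le> c \<Longrightarrow> (b - a) / 2 \<le> d - c \<Longrightarrow> d \<le> b \<Longrightarrow> 0 \<le> h \<Longrightarrow> h \<le> b \<Longrightarrow>
      \<bar>uniform_renewal.G c d h x - 2 * h / (c + d)\<bar> \<le> C1 * exp (- \<gamma>1 * x)"
    using renewal_rate_uniform[of "(b - a) / 2" b] ab b by auto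
  define \<rho> where "\<rho> = 1 - \<delta> / (b - a)"
  have "\<delta> / (b - a) \<le> 1 / 2" "0 < \<delta> / (b - a)" using \<delta> ab by (auto simp: field_simps)
  then have \<rho>: "0 < \<rho>" "\<rho> < 1" unfolding \<rho>_def by linarith+
  obtain C3 \<gamma>3 where C3: "0 < C3" "0 < \<gamma>3" and bad:
    "\<And>n w. 1 \<le> n \<Longrightarrow> w \<le> real n \<Longrightarrow> (real n + 2) * \<rho> ^ (n - 1) \<le> C3 * exp (- \<gamma>3 * w)"
    using bad_regime_le[OF \<rho>] by blast
  define C2 where "C2 = 1 + 8 / (\<theta> * b)"
  define \<gamma>2 where "\<gamma>2 = \<theta> * (\<epsilon>' * \<mu>) / 2"
  have C2: "0 < C2" "0 < \<gamma>2" using \<theta> b \<epsilon>' \<mu> by (auto simp: C2_def \<gamma>2_def intro!: add_pos_pos)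
  show thesis
  proof (rule that[of "C1 + C2 + C3" "Min {\<gamma>1 * \<mu>, \<gamma>2, \<gamma>3}"])
    fix n :: nat and q :: real
    assume n: "1 \<le> n" and q: "real n powr (-3/4) \<le> q" "q \<le> 1 - \<epsilon>"
    interpret extremal_weight a b 1 "\<lambda>_. a" "\<lambda>t. t"
      using ab by unfold_locales (auto simp: beats_def split: if_splits)
    define w where "w = real n powr (1/4)"
    have w: "0 \<le> w" "w \<le> n" using powr_quarter_le[OF n] by (auto simp: w_def)
    define Q where "Q = q * real n * \<mu>"
    have Q: "w * \<mu> \<le> Q" using quota_lower[OF n q(1), of \<mu>] \<mu> by (simp add: w_def Q_def)
    have Q_le: "Q \<le> (1 - \<epsilon>') * (n * \<mu>)"
      unfolding Q_def mult.assoc using q(2) \<epsilon>' \<mu> by (intro mult_right_mono) auto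
    define e where "e = C1 * exp (- (\<gamma>1 * \<mu>) * w) + C2 * exp (- \<gamma>2 * w)"
    have "\<bar>exp_shapley n a b (n - 1) Q - 1 / (b - a) * integral {a..b} (\<lambda>t. p t ^ (n - 1) * (2 * t / (a + t)))\<bar>
        \<le> e + (real n + 2) * \<rho> ^ (n - 1)"
    proof (rule exp_shapley_approx_two_regimes[where P = "\<lambda>t. b - \<delta> \<le> t"])
      show "p \<in> borel_measurable borel" unfolding p_def[abs_def] by measurable
      show "(\<lambda>t. 2 * t / (a + t)) \<in> borel_measurable borel" by measurable
      show "0 \<le> p t \<and> p t \<le> 1" if "t \<in> {a..b}" for t
        using that ab by (simp add: p_def)
      show "\<bar>2 * t / (a + t)\<bar> \<le> 2" if "t \<in> {a..b}" for t
        using that ab by (cases "t = 0") (auto simp: field_simps)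
      show "p t \<le> \<rho>" if "\<not> b - \<delta> \<le> t" for t
      proof -
        have "(t - a) / (b - a) \<le> (b - a - \<delta>) / (b - a)"
          using that ab by (intro divide_right_mono) auto
        also have "\<dots> = \<rho>" using ab by (simp add: \<rho>_def diff_divide_distrib)
        finally show ?thesis by (simp add: p_def)
      qed
      show "0 \<le> e" using C1 C2 by (simp add: e_def)
      fix t assume t: "a < t" "t < b" and good: "b - \<delta> \<le> t"
      interpret R: uniform_renewal a t t using ab t by unfold_locales auto
      have "\<bar>R.G Q - 2 * t / (a + t)\<bar> \<le> C1 * exp (- \<gamma>1 * Q)"
      proof (rule rate)
        show "(b - a) / 2 \<le> t - a" using good \<delta>(2) by (simp add: field_simps)
      qed (use t ab in auto)
      also have "\<dots> \<le> C1 * exp (- (\<gamma>1 * \<mu>) * w)"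
        using mult_left_mono[OF Q, of \<gamma>1] C1 by (simp add: mult_ac)
      finally have 1: "\<bar>R.G Q - 2 * t / (a + t)\<bar> \<le> C1 * exp (- (\<gamma>1 * \<mu>) * w)" .
      have mean: "\<mu> - \<epsilon>' * \<mu> / 4 \<le> (a + t) / 2"
      proof -
        have "2 * \<mu> = a + b" by (simp add: \<mu>_def)
        moreover have "m - X / 4 \<le> (a + t) / 2" if "2 * m = a + b" "\<delta> \<le> X / 2" for m X
          using that good by (simp add: field_simps)
        ultimately show ?thesis using \<delta>(3) by blast
      qed
      have tb: "\<theta> * t\<^sup>2 \<le> \<epsilon>' * \<mu> / 4"
        unfolding \<theta>b[symmetric] using t ab \<theta> by (intro mult_left_mono power_mono) auto
      have "\<epsilon>' * \<mu> \<le> \<mu>" using \<epsilon>' \<mu> by simp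
      have 2: "\<bar>(\<Sum>m<n. window_prob a t t m Q) - R.G Q\<bar> \<le> C2 * exp (- \<gamma>2 * w)"
      proof (rule order_trans[OF R.tail_le_exp[OF \<theta>]])
        show "\<theta> * t\<^sup>2 \<le> (a + t) / 2" using tb mean \<open>\<epsilon>' * \<mu> \<le> \<mu>\<close> \<mu> by linarith
        have "Q - n * ((a + t) / 2) \<le> n * (- (3/4) * (\<epsilon>' * \<mu>))"
        proof -
          have "n * (\<mu> - \<epsilon>' * \<mu> / 4) \<le> n * ((a + t) / 2)" using mean by (intro mult_left_mono) auto
          then show ?thesis using Q_le by (simp add: algebra_simps)
        qed
        then have "\<theta> * (Q - n * ((a + t) / 2)) \<le> \<theta> * (n * (- (3/4) * (\<epsilon>' * \<mu>)))"
          using \<theta> by (intro mult_left_mono) auto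
        moreover have "n * (\<theta>\<^sup>2 * t\<^sup>2 / 2) \<le> \<theta> * (n * (1/8 * (\<epsilon>' * \<mu>)))"
        proof -
          have "n * \<theta> / 2 * (\<theta> * t\<^sup>2) \<le> n * \<theta> / 2 * (\<epsilon>' * \<mu> / 4)"
            using tb \<theta> by (intro mult_left_mono) auto
          then show ?thesis by (simp add: power2_eq_square mult_ac)
        qed
        \<comment> \<open>The net gain is \<open>3/4 - 1/8 = 5/8\<close>, while
          \<open>\<gamma>2\<close> carries the factor \<open>1/2\<close>.\<close>
        ultimately have "\<theta> * (Q - n * ((a + t) / 2)) + n * (\<theta>\<^sup>2 * t\<^sup>2 / 2) \<le> - (5/4) * (\<gamma>2 * n)"
          by (simp add: \<gamma>2_def algebra_simps)
        also have "\<dots> \<le> - (\<gamma>2 * n)" using C2 by simp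
        also have "\<dots> \<le> - \<gamma>2 * w" using w C2 by simp
        finally have ex: "exp (\<theta> * (Q - n * ((a + t) / 2)) + n * (\<theta>\<^sup>2 * t\<^sup>2 / 2)) \<le> exp (- \<gamma>2 * w)"
          by simp
        have "b / 2 \<le> a + t" using good \<delta>(2) ab by (simp add: field_simps)
        then have "4 / (\<theta> * (a + t)) \<le> 4 / (\<theta> * (b / 2))"
          using \<theta> b by (intro divide_left_mono mult_left_mono mult_pos_pos) auto
        then have "1 + 4 / (\<theta> * (a + t)) \<le> C2" by (simp add: C2_def)
        then have "exp (\<theta> * (Q - n * ((a + t) / 2)) + n * (\<theta>\<^sup>2 * t\<^sup>2 / 2)) * (1 + 4 / (\<theta> * (a + t)))
            \<le> exp (- \<gamma>2 * w) * C2"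
          using ex \<theta> t ab by (intro mult_mono) (auto intro!: add_nonneg_nonneg)
        then show "exp (\<theta> * (Q - n * ((a + t) / 2)) + n * (\<theta>\<^sup>2 * t\<^sup>2 / 2)) * (1 + 4 / (\<theta> * (a + t)))
            \<le> C2 * exp (- \<gamma>2 * w)" by (simp add: mult.commute)
      qed
      show "\<bar>(\<Sum>m<n. window_prob a t t m Q) - 2 * t / (a + t)\<bar> \<le> e"
        using 1 2 unfolding e_def by linarith
    qed (use n \<rho> in auto)
    also have "\<dots> \<le> (C1 + C2 + C3) * exp (- Min {\<gamma>1 * \<mu>, \<gamma>2, \<gamma>3} * w)"
      unfolding e_def using C1 C2 C3 w bad[OF n w(2)] by (intro exp_sum3_le) auto
    finally show "\<bar>exp_shapley n a b (n - 1) (q * real n * mean_unif a b)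
        - 1 / (b - a) * integral {a..b} (\<lambda>t. ((t - a) / (b - a)) ^ (n - 1) * (2 * t / (a + t)))\<bar>
      \<le> (C1 + C2 + C3) * exp (- Min {\<gamma>1 * \<mu>, \<gamma>2, \<gamma>3} * real n powr (1/4))"
      unfolding Q_def w_def p_def \<mu>_def mean_unif_eq[OF ab(2)] .
  qed (use C1 C2 C3 \<mu> in auto)
qed

text \<open>The mean step \<open>(t + b) / 2\<close> is at least \<open>\<mu>\<close> for every
  \<open>t\<close>, so only short step intervals are bad. The threshold \<open>\<mu>\<close> handles
  them: below it \<open>[t, b]\<close> has at least half the length of \<open>[a, b]\<close>, above
  it \<open>p t \<le> 1/2\<close>.\<close>

lemma exp_shapley_min_approx:
  fixes a b :: real
  assumes ab: "0 \<le> a" "a < b"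
  obtains K C \<gamma> where "0 < K" "0 < C" "0 < \<gamma>"
    "\<And>n q. 1 \<le> n \<Longrightarrow> real n powr (-3/4) \<le> q \<Longrightarrow> q \<le> 1 - K * real n powr (-1/3) \<Longrightarrow>
      \<bar>exp_shapley n a b 0 (q * real n * mean_unif a b)
        - 1 / (b - a) * integral {a..b} (\<lambda>t. ((b - t) / (b - a)) ^ (n - 1) * (2 * t / (b + t)))\<bar>
      \<le> C * exp (- \<gamma> * real n powr (1/4))"
proof -
  define \<mu> where "\<mu> = (a + b) / 2"
  define \<kappa> where "\<kappa> = \<mu> / b\<^sup>2"
  define \<alpha> where "\<alpha> = \<kappa> * \<mu>"
  have b: "0 < b" using ab by simp
  have \<mu>: "0 < \<mu>" using ab by (simp add: \<mu>_def)
  have \<kappa>: "0 < \<kappa>" "\<kappa> * b\<^sup>2 = \<mu>" using \<mu> b by (auto simp: \<kappa>_def)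
  have \<alpha>: "0 < \<alpha>" using \<mu> \<kappa> by (simp add: \<alpha>_def)
  obtain C1 \<gamma>1 where C1: "0 < C1" "0 < \<gamma>1" and rate:
    "\<And>c d h x. 0 \<le> c \<Longrightarrow> (b - a) / 2 \<le> d - c \<Longrightarrow> d \<le> b \<Longrightarrow> 0 \<le> h \<Longrightarrow> h \<le> b \<Longrightarrow>
      \<bar>uniform_renewal.G c d h x - 2 * h / (c + d)\<bar> \<le> C1 * exp (- \<gamma>1 * x)"
    using renewal_rate_uniform[of "(b - a) / 2" b] ab b by auto
  obtain C3 \<gamma>3 where C3: "0 < C3" "0 < \<gamma>3" and bad:
    "\<And>n w. 1 \<le> n \<Longrightarrow> w \<le> real n \<Longrightarrow> (real n + 2) * (1/2) ^ (n - 1) \<le> C3 * exp (- \<gamma>3 * w)"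
    using bad_regime_le[of "1/2"] by auto
  \<comment> \<open>The prefactor of the tail grows like \<open>2 / \<alpha> * v\<close> with
    \<open>v = n powr (1/3)\<close>; absorbing it costs half of the exponent
    \<open>\<alpha> * v\<close> and produces \<open>4 / \<alpha>\<^sup>2\<close>.\<close>
  define C2 where "C2 = 1 + 4 / \<alpha>\<^sup>2"
  define \<gamma>2 where "\<gamma>2 = \<alpha> / 2"
  have C2: "0 < C2" "0 < \<gamma>2" using \<alpha> by (auto simp: C2_def \<gamma>2_def intro!: add_pos_pos)
  show thesis
  \<comment> \<open>With \<open>K = 3/2\<close> the linear gain \<open>3/2 * (\<alpha> * v)\<close>
    exceeds the quadratic loss \<open>1/2 * (\<alpha> * v)\<close> by exactly
    \<open>\<alpha> * v\<close>.\<close>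
  proof (rule that[of "3/2" "C1 + C2 + C3" "Min {\<gamma>1 * \<mu>, \<gamma>2, \<gamma>3}"])
    fix n :: nat and q :: real
    assume n: "1 \<le> n" and q: "real n powr (-3/4) \<le> q" "q \<le> 1 - 3/2 * real n powr (-1/3)"
    interpret extremal_weight a b "-1" "\<lambda>t. t" "\<lambda>_. b"
      using ab by unfold_locales (auto simp: beats_def split: if_splits)
    define w where "w = real n powr (1/4)"
    define v where "v = real n powr (1/3)"
    have w: "0 \<le> w" "w \<le> n" "w \<le> v" using powr_quarter_le[OF n] by (auto simp: w_def v_def)
    have v: "0 < v" "1 \<le> v" using n by (auto simp: v_def intro: ge_one_powr_ge_zero)
    have n_eq: "real n = v * v * v"
      unfolding v_def powr_add[symmetric] using n by simp
    have v_inv: "real n powr (-1/3) = 1 / v"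
      unfolding v_def using powr_minus_divide[of "real n" "1/3"] by simp
    \<comment> \<open>As \<open>n = v * v * v\<close>, both \<open>\<theta>\<close> times the gap of
      order \<open>n / v\<close> and the loss of order \<open>n * \<theta>\<^sup>2\<close> are then
      of order \<open>v\<close>.\<close>
    define \<theta> where "\<theta> = \<kappa> / v"
    have \<theta>: "0 < \<theta>" using \<kappa> v by (simp add: \<theta>_def)
    define Q where "Q = q * real n * \<mu>"
    have Q: "w * \<mu> \<le> Q" using quota_lower[OF n q(1), of \<mu>] \<mu> by (simp add: w_def Q_def)
    have Q_le: "Q \<le> (1 - 3/2 * (1 / v)) * (n * \<mu>)"
      unfolding Q_def mult.assoc using q(2)[unfolded v_inv] \<mu> by (intro mult_right_mono) auto
    define e where "e = C1 * exp (- (\<gamma>1 * \<mu>) * w) + C2 * exp (- \<gamma>2 * w)"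
    have "\<bar>exp_shapley n a b 0 Q - 1 / (b - a) * integral {a..b} (\<lambda>t. p t ^ (n - 1) * (2 * t / (b + t)))\<bar>
        \<le> e + (real n + 2) * (1/2) ^ (n - 1)"
    proof (rule exp_shapley_approx_two_regimes[where P = "\<lambda>t. t \<le> \<mu>"])
      show "p \<in> borel_measurable borel" unfolding p_def[abs_def] by measurable
      show "(\<lambda>t. 2 * t / (b + t)) \<in> borel_measurable borel" by measurable
      show "0 \<le> p t \<and> p t \<le> 1" if "t \<in> {a..b}" for t
        using that ab by (simp add: p_def)
      show "\<bar>2 * t / (b + t)\<bar> \<le> 2" if "t \<in> {a..b}" for t
        using that ab by (auto simp: field_simps)
      show "p t \<le> 1 / 2" if "\<not> t \<le> \<mu>" for t
        using that ab by (simp add: p_def \<mu>_def field_simps)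
      show "0 \<le> e" using C1 C2 by (simp add: e_def)
      fix t assume t: "a < t" "t < b" and good: "t \<le> \<mu>"
      interpret R: uniform_renewal t b t using ab t by unfold_locales auto
      have "\<bar>R.G Q - 2 * t / (t + b)\<bar> \<le> C1 * exp (- \<gamma>1 * Q)"
      proof (rule rate)
        show "(b - a) / 2 \<le> b - t" using good by (simp add: \<mu>_def field_simps)
      qed (use t ab in auto)
      also have "\<dots> \<le> C1 * exp (- (\<gamma>1 * \<mu>) * w)"
        using mult_left_mono[OF Q, of \<gamma>1] C1 by (simp add: mult_ac)
      finally have 1: "\<bar>R.G Q - 2 * t / (b + t)\<bar> \<le> C1 * exp (- (\<gamma>1 * \<mu>) * w)"
        by (simp only: add.commute)
      have mean: "\<mu> \<le> (t + b) / 2" using t by (simp add: \<mu>_def)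
      have 2: "\<bar>(\<Sum>m<n. window_prob t b t m Q) - R.G Q\<bar> \<le> C2 * exp (- \<gamma>2 * w)"
      proof (rule order_trans[OF R.tail_le_exp[OF \<theta>]])
        have "\<theta> * b\<^sup>2 = \<mu> / v" using \<kappa> by (simp add: \<theta>_def)
        also have "\<dots> \<le> \<mu>" using v \<mu> by (simp add: divide_le_eq)
        finally show "\<theta> * b\<^sup>2 \<le> (t + b) / 2" using mean by simp
        have "Q - n * ((t + b) / 2) \<le> - (3/2 * (1 / v) * (n * \<mu>))"
        proof -
          have "n * \<mu> \<le> n * ((t + b) / 2)" using mean by (intro mult_left_mono) auto
          then show ?thesis using Q_le by (simp add: left_diff_distrib)
        qed
        then have "\<theta> * (Q - n * ((t + b) / 2)) \<le> \<theta> * - (3/2 * (1 / v) * (n * \<mu>))"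
          using \<theta> by (intro mult_left_mono) auto
        also have "\<dots> = - (3/2) * (\<alpha> * v)"
          unfolding \<theta>_def \<alpha>_def n_eq using v by (simp add: field_simps)
        finally have lin: "\<theta> * (Q - n * ((t + b) / 2)) \<le> - (3/2) * (\<alpha> * v)" .
        have quad: "n * (\<theta>\<^sup>2 * b\<^sup>2 / 2) = 1/2 * (\<alpha> * v)"
        proof -
          have "n * (\<theta>\<^sup>2 * b\<^sup>2 / 2) = \<kappa> * (\<kappa> * b\<^sup>2) * v / 2"
            unfolding \<theta>_def n_eq power2_eq_square using v by (simp add: field_simps)
          then show ?thesis unfolding \<kappa>(2) by (simp add: \<alpha>_def)
        qed
        have ex: "exp (\<theta> * (Q - n * ((t + b) / 2)) + n * (\<theta>\<^sup>2 * b\<^sup>2 / 2)) \<le> exp (- \<alpha> * v)"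
          using lin quad by simp
        have "\<theta> * (2 * \<mu>) \<le> \<theta> * (t + b)" using mean \<theta> by (intro mult_left_mono) auto
        then have "4 / (\<theta> * (t + b)) \<le> 4 / (\<theta> * (2 * \<mu>))"
          using \<theta> \<mu> t ab by (intro divide_left_mono mult_pos_pos) auto
        also have "\<dots> = 2 / \<alpha> * v"
          using \<kappa> \<mu> v by (simp add: \<theta>_def \<alpha>_def field_simps)
        finally have "1 + 4 / (\<theta> * (t + b)) \<le> 1 + 2 / \<alpha> * v" by simp
        then have "exp (\<theta> * (Q - n * ((t + b) / 2)) + n * (\<theta>\<^sup>2 * b\<^sup>2 / 2)) * (1 + 4 / (\<theta> * (t + b)))
            \<le> exp (- \<alpha> * v) * (1 + 2 / \<alpha> * v)"
          using ex \<theta> t ab by (intro mult_mono) (auto intro!: add_nonneg_nonneg)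
        also have "\<dots> = exp (- \<alpha> * v) + 2 / \<alpha> * (v * exp (- \<alpha> * v))" by (simp add: algebra_simps)
        also have "\<dots> \<le> exp (- (\<alpha> / 2) * v) + 2 / \<alpha> * (2 / \<alpha> * exp (- (\<alpha> / 2) * v))"
          using \<alpha> v linear_exp_le[OF \<alpha>, of v] by (intro add_mono mult_left_mono) auto
        also have "\<dots> = C2 * exp (- \<gamma>2 * v)"
          by (simp add: C2_def \<gamma>2_def power2_eq_square algebra_simps)
        also have "\<dots> \<le> C2 * exp (- \<gamma>2 * w)"
          using C2 w by (intro mult_left_mono) auto
        finally show "exp (\<theta> * (Q - n * ((t + b) / 2)) + n * (\<theta>\<^sup>2 * b\<^sup>2 / 2)) * (1 + 4 / (\<theta> * (t + b)))
            \<le> C2 * exp (- \<gamma>2 * w)" .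
      qed
      show "\<bar>(\<Sum>m<n. window_prob t b t m Q) - 2 * t / (b + t)\<bar> \<le> e"
        using 1 2 unfolding e_def by linarith
    qed (use n in auto)
    also have "\<dots> \<le> (C1 + C2 + C3) * exp (- Min {\<gamma>1 * \<mu>, \<gamma>2, \<gamma>3} * w)"
      unfolding e_def using C1 C2 C3 w bad[OF n w(2)] by (intro exp_sum3_le) auto
    finally show "\<bar>exp_shapley n a b 0 (q * real n * mean_unif a b)
        - 1 / (b - a) * integral {a..b} (\<lambda>t. ((b - t) / (b - a)) ^ (n - 1) * (2 * t / (b + t)))\<bar>
      \<le> (C1 + C2 + C3) * exp (- Min {\<gamma>1 * \<mu>, \<gamma>2, \<gamma>3} * real n powr (1/4))"
      unfolding Q_def w_def p_def \<mu>_def mean_unif_eq[OF ab(2)] .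
  qed (use C1 C2 C3 \<mu> in auto)
qed

theorem theorem2:
  fixes a b :: real
  assumes "0 \<le> a" and "a < b"
  shows
   "(\<forall>\<epsilon>>0. \<exists>\<psi> K C. 0 < \<psi> \<and> \<psi> < 1 \<and> K > 0 \<and>
      (\<forall>(n::nat) (q::real). n \<ge> 1 \<longrightarrow>
          real n powr (-3/4) \<le> q \<and> q \<le> 1 - \<epsilon> \<longrightarrow>
          \<bar>exp_shapley n a b (n - 1) (q * real n * mean_unif a b)
            - (1 / (b - a)) * integral {a..b} (\<lambda>t. ((t - a) / (b - a)) ^ (n - 1) * (2 * t / (a + t)))\<bar>
          \<le> C * \<psi> powr (real n powr (1/4))) \<and>
      (\<forall>(n::nat) (q::real). n \<ge> 1 \<longrightarrow>
          real n powr (-3/4) \<le> q \<and> q \<le> 1 - K * real n powr (-1/3) \<longrightarrow>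
          \<bar>exp_shapley n a b 0 (q * real n * mean_unif a b)
            - (1 / (b - a)) * integral {a..b} (\<lambda>t. ((b - t) / (b - a)) ^ (n - 1) * (2 * t / (b + t)))\<bar>
          \<le> C * \<psi> powr (real n powr (1/4))))
   \<and>
   (\<forall>n::nat. n \<ge> 1 \<longrightarrow>
      (1 / (b - a)) * integral {a..b} (\<lambda>t. ((t - a) / (b - a)) ^ (n - 1) * (2 * t / (a + t)))
        = 2 * b / (a + b) * (1 / real n)
          - 2 * a / (a + b) * (\<Sum>d. ((b - a) / (a + b)) ^ Suc d * fact (Suc d)
                                     / pochhammer (real n) (Suc (Suc d)))
      \<and> (a = 0 \<longrightarrow>
          (1 / (b - a)) * integral {a..b} (\<lambda>t. ((t - a) / (b - a)) ^ (n - 1) * (2 * t / (a + t)))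
            = 2 / real n)
      \<and> (1 / (b - a)) * integral {a..b} (\<lambda>t. ((b - t) / (b - a)) ^ (n - 1) * (2 * t / (b + t)))
        = 2 * a / (a + b) * (1 / real n)
          - 2 * b / (a + b) * (\<Sum>d. ((a - b) / (a + b)) ^ Suc d * fact (Suc d)
                                     / pochhammer (real n) (Suc (Suc d)))
      \<and> (a = 0 \<longrightarrow>
          (1 / (b - a)) * integral {a..b} (\<lambda>t. ((b - t) / (b - a)) ^ (n - 1) * (2 * t / (b + t)))
            = 2 * (\<Sum>d. (-1) ^ (Suc d + 1) * fact (Suc d) / pochhammer (real n) (Suc (Suc d)))))"
proof (intro conjI allI impI)
  fix \<epsilon> :: real assume "0 < \<epsilon>"
  obtain C1 \<gamma>1 where 1: "0 < C1" "0 < \<gamma>1"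
    "\<And>n q. 1 \<le> n \<Longrightarrow> real n powr (-3/4) \<le> q \<Longrightarrow> q \<le> 1 - \<epsilon> \<Longrightarrow>
      \<bar>exp_shapley n a b (n - 1) (q * real n * mean_unif a b)
        - 1 / (b - a) * integral {a..b} (\<lambda>t. ((t - a) / (b - a)) ^ (n - 1) * (2 * t / (a + t)))\<bar>
      \<le> C1 * exp (- \<gamma>1 * real n powr (1/4))"
    using exp_shapley_max_approx[OF assms \<open>0 < \<epsilon>\<close>] by blast
  obtain K C2 \<gamma>2 where 2: "0 < K" "0 < C2" "0 < \<gamma>2"
    "\<And>n q. 1 \<le> n \<Longrightarrow> real n powr (-3/4) \<le> q \<Longrightarrow> q \<le> 1 - K * real n powr (-1/3) \<Longrightarrow>
      \<bar>exp_shapley n a b 0 (q * real n * mean_unif a b)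
        - 1 / (b - a) * integral {a..b} (\<lambda>t. ((b - t) / (b - a)) ^ (n - 1) * (2 * t / (b + t)))\<bar>
      \<le> C2 * exp (- \<gamma>2 * real n powr (1/4))"
    using exp_shapley_min_approx[OF assms] by blast
  \<comment> \<open>One base \<open>\<psi> = exp (- \<gamma>)\<close> and one constant have to serve
    both agents.\<close>
  define \<gamma> where "\<gamma> = min \<gamma>1 \<gamma>2"
  define C where "C = max C1 C2"
  have le: "C' * exp (- \<gamma>' * w) \<le> C * exp (- \<gamma>) powr w"
    if "0 \<le> w" "0 < C'" "C' \<le> C" "\<gamma> \<le> \<gamma>'" for C' \<gamma>' w :: real
  proof -
    have "C' * exp (- \<gamma>' * w) \<le> C * exp (- \<gamma> * w)"
      using that by (intro mult_mono) (auto intro: mult_right_mono)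
    also have "exp (- \<gamma> * w) = exp (- \<gamma>) powr w" by (simp add: powr_def mult.commute)
    finally show ?thesis .
  qed
  have C: "C1 \<le> C" "C2 \<le> C" "\<gamma> \<le> \<gamma>1" "\<gamma> \<le> \<gamma>2" by (auto simp: C_def \<gamma>_def)
  show "\<exists>\<psi> K C. 0 < \<psi> \<and> \<psi> < 1 \<and> K > 0 \<and>
      (\<forall>(n::nat) (q::real). n \<ge> 1 \<longrightarrow>
          real n powr (-3/4) \<le> q \<and> q \<le> 1 - \<epsilon> \<longrightarrow>
          \<bar>exp_shapley n a b (n - 1) (q * real n * mean_unif a b)
            - (1 / (b - a)) * integral {a..b} (\<lambda>t. ((t - a) / (b - a)) ^ (n - 1) * (2 * t / (a + t)))\<bar>
          \<le> C * \<psi> powr (real n powr (1/4))) \<and>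
      (\<forall>(n::nat) (q::real). n \<ge> 1 \<longrightarrow>
          real n powr (-3/4) \<le> q \<and> q \<le> 1 - K * real n powr (-1/3) \<longrightarrow>
          \<bar>exp_shapley n a b 0 (q * real n * mean_unif a b)
            - (1 / (b - a)) * integral {a..b} (\<lambda>t. ((b - t) / (b - a)) ^ (n - 1) * (2 * t / (b + t)))\<bar>
          \<le> C * \<psi> powr (real n powr (1/4)))"
  proof (rule exI[of _ "exp (- \<gamma>)"], rule exI[of _ K], rule exI[of _ C],
      intro conjI allI impI; (elim conjE)?)
    show "exp (- \<gamma>) < 1" using 1 2 by (simp add: \<gamma>_def)
  next
    fix n :: nat and q :: real
    assume "1 \<le> n" "real n powr (-3/4) \<le> q" "q \<le> 1 - \<epsilon>"
    from 1(3)[OF this] show "\<bar>exp_shapley n a b (n - 1) (q * real n * mean_unif a b)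
            - (1 / (b - a)) * integral {a..b} (\<lambda>t. ((t - a) / (b - a)) ^ (n - 1) * (2 * t / (a + t)))\<bar>
          \<le> C * exp (- \<gamma>) powr (real n powr (1/4))"
      by (rule order_trans) (rule le[OF _ 1(1) C(1,3)], simp)
  next
    fix n :: nat and q :: real
    assume "1 \<le> n" "real n powr (-3/4) \<le> q" "q \<le> 1 - K * real n powr (-1/3)"
    from 2(4)[OF this] show "\<bar>exp_shapley n a b 0 (q * real n * mean_unif a b)
            - (1 / (b - a)) * integral {a..b} (\<lambda>t. ((b - t) / (b - a)) ^ (n - 1) * (2 * t / (b + t)))\<bar>
          \<le> C * exp (- \<gamma>) powr (real n powr (1/4))"
      by (rule order_trans) (rule le[OF _ 2(2) C(2,4)], simp)
  qed (use 2 in auto)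
next
  fix n :: nat assume "1 \<le> n"
  then obtain m where n: "n = Suc m" by (cases n) auto
  have b: "0 < b" using assms by simp
  have max_zero: "(1 / (b - a)) * integral {a..b} (\<lambda>t. ((t - a) / (b - a)) ^ (n - 1) * (2 * t / (a + t))) = 2 / real n"
    if "a = 0"
    using max_integral_zero[OF b, of m] that n by simp
  then show "a = 0 \<Longrightarrow>
      (1 / (b - a)) * integral {a..b} (\<lambda>t. ((t - a) / (b - a)) ^ (n - 1) * (2 * t / (a + t))) = 2 / real n" .
  show "(1 / (b - a)) * integral {a..b} (\<lambda>t. ((t - a) / (b - a)) ^ (n - 1) * (2 * t / (a + t)))
        = 2 * b / (a + b) * (1 / real n)
          - 2 * a / (a + b) * (\<Sum>d. ((b - a) / (a + b)) ^ Suc d * fact (Suc d)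
                                     / pochhammer (real n) (Suc (Suc d)))"
  proof (cases "a = 0")
    \<comment> \<open>The ratio is 1 here, and for \<open>n = 1\<close> the series diverges;
      whatever value the sum has, its coefficient \<open>2 * a / (a + b)\<close> is 0.\<close>
    case True
    then show ?thesis using max_zero[OF True] b by simp
  next
    case False
    then show ?thesis
      using extremal_integral_series(2)[of a b m] assms n by (simp add: min_def max_def)
  qed
  \<comment> \<open>The formula for the smallest agent is that for the largest with \<open>a\<close>
    and \<open>b\<close> exchanged.\<close>
  have rev: "(t - b) / (a - b) = (b - t) / (b - a)" for t
    by (metis minus_diff_eq minus_divide_divide)
  show min: "(1 / (b - a)) * integral {a..b} (\<lambda>t. ((b - t) / (b - a)) ^ (n - 1) * (2 * t / (b + t)))
        = 2 * a / (a + b) * (1 / real n)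
          - 2 * b / (a + b) * (\<Sum>d. ((a - b) / (a + b)) ^ Suc d * fact (Suc d)
                                     / pochhammer (real n) (Suc (Suc d)))"
    using extremal_integral_series(2)[of b a m] assms b n
    unfolding rev by (simp add: min_def max_def add.commute)
  show "(1 / (b - a)) * integral {a..b} (\<lambda>t. ((b - t) / (b - a)) ^ (n - 1) * (2 * t / (b + t)))
        = 2 * (\<Sum>d. (-1) ^ (Suc d + 1) * fact (Suc d) / pochhammer (real n) (Suc (Suc d)))" if "a = 0"
  proof -
    let ?f = "\<lambda>d. ((a - b) / (b + a)) ^ Suc d * fact (Suc d) / pochhammer (real (Suc m)) (Suc (Suc d))"
    have r: "(a - b) / (b + a) = -1" using that b by simp
    \<comment> \<open>Moving the sign through \<open>suminf\<close> requires convergence, which for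
      ratio \<open>-1\<close> and \<open>n = 1\<close> is only conditional.\<close>
    have "summable ?f" using assms b by (intro extremal_integral_series(1)) auto
    then have "(\<Sum>d. - ?f d) = - suminf ?f" by (rule suminf_minus)
    then have "(\<Sum>d. (-1) ^ (Suc d + 1) * fact (Suc d) / pochhammer (real n) (Suc (Suc d))) = - suminf ?f"
      unfolding r n by simp
    then show ?thesis unfolding min using that b n by (simp add: add.commute)
  qed
qed

end
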